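(* Let $A:\mathcal{H}\to 2^{\mathcal{H}}$ be maximally monotone with $\operatorname{zer}A\neq\varnothing$, let $u,x_0\in\mathcal{H}$, let $(e_k)_{k\in\mathbb{N}}$ be a sequence in $\mathcal{H}$, let $(c_k)_{k\in\mathbb{N}}$ be a sequence of strictly positive reals, let $(\alpha_k)_{k\in\mathbb{N}},(\beta_k)_{k\in\mathbb{N}},(\gamma_k)_{k\in\mathbb{N}},(\delta_k)_{k\in\mathbb{N}}$ be sequences in $\mathbb{R}$, and let $(x_k)_{k\in\mathbb{N}}$ be generated by $$(\forall k\in\mathbb{N})\quad x_{k+1}=\alpha_k u+\beta_k x_k+\gamma_k J_{c_kA}(x_k)+\delta_k e_k .$$ Suppose that $(\forall k\in\mathbb{N})$ $\left|\beta_k+\frac{\gamma_k}{2}\right|+\left|\frac{\gamma_k}{2}\right|\le 1$, that $\sum_{k\in\mathbb{N}}|\alpha_k|<\infty$, $\sum_{k\in\mathbb{N}}|1-\beta_k-\gamma_k|<\infty$, and $\sum_{k\in\mathbb{N}}\|\delta_ke_k\|<\infty$, and that one of the following holds. (i) $\gamma_k\to 1$, and [$\inf_{k\in\mathbb{N}}c_k>0$ or $c_k\to\infty$]. (ii) $\limsup_{k\to\infty}|\beta_k|<1$ and $0<\liminf_{k\to\infty}\left(1-\beta_k-\frac{\gamma_k}{2}\right)\le\limsup_{k\to\infty}\left(1-\beta_k-\frac{\gamma_k}{2}\right)<1$; $1-\frac{c_k}{c_{k+1}}\to 0$; and [$\inf_{k\in\mathbb{N}}c_k>0$ or $c_k\to\infty$].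 (iii) $\inf_{k\in\mathbb{N}}\gamma_k(\beta_k+\gamma_k)\ge 0$ and $\liminf_{k\to\infty}\gamma_k(2\beta_k+\gamma_k)>0$, and [$\inf_{k\in\mathbb{N}}c_k>0$ or $c_k\to\infty$]. (iv) $\inf_{k\in\mathbb{N}}\gamma_k(\beta_k+\gamma_k)\ge 0$ and $\inf_{k\in\mathbb{N}}\gamma_k(2\beta_k+\gamma_k)\ge 0$; $\sum_{k\in\mathbb{N}}\gamma_k(2\beta_k+\gamma_k)=\infty$; $(\forall k\in\mathbb{N})$ $|\beta_k+\gamma_k|\,|\gamma_k|\le\max\left\{1-|\beta_k|,\ 2-2\left|\beta_k+\frac{\gamma_k}{2}\right|\right\}$; and $\inf_{k\in\mathbb{N}}c_k>0$ and $\sum_{k\in\mathbb{N}}|c_{k+1}-c_k|<\infty$. Then $(x_k)_{k\in\mathbb{N}}$ converges weakly to a point in $\operatorname{zer}A$.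
   Context: $\mathcal{H}\neq\{0\}$ is a real Hilbert space with inner product $\langle\cdot,\cdot\rangle$ and induced norm $\|\cdot\|$; $\mathbb{N}=\{0,1,2,\ldots\}$. A set-valued operator $A:\mathcal{H}\to 2^{\mathcal{H}}$ has graph $\operatorname{gra}A=\{(x,w): w\in A(x)\}$; it is monotone if $\langle x-y,w-v\rangle\ge 0$ for all $(x,w),(y,v)\in\operatorname{gra}A$, and maximally monotone if moreover no monotone operator has a graph properly containing $\operatorname{gra}A$. $\operatorname{zer}A=\{x\in\mathcal{H}: 0\in A(x)\}$. For $c>0$, $J_{cA}=(\mathrm{Id}+cA)^{-1}$ is the resolvent of $cA$; for $A$ maximally monotone it is a single-valued map defined on all of $\mathcal{H}$. *)

theory Defs
  imports "HOL-Analysis.Analysis"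
begin

definition graph_op :: "('a \<Rightarrow> 'a set) \<Rightarrow> ('a \<times> 'a) set" where
  "graph_op A = {(x, w). w \<in> A x}"

definition monotone_op :: "('a::real_inner \<Rightarrow> 'a set) \<Rightarrow> bool" where
  "monotone_op A \<longleftrightarrow>
     (\<forall>(x, w) \<in> graph_op A. \<forall>(y, v) \<in> graph_op A. inner (x - y) (w - v) \<ge> 0)"

definition maximally_monotone :: "('a::real_inner \<Rightarrow> 'a set) \<Rightarrow> bool" where
  "maximally_monotone A \<longleftrightarrow>
     monotone_op A \<and> \<not> (\<exists>B. monotone_op B \<and> graph_op A \<subset> graph_op B)"

definition zer :: "('a::real_vector \<Rightarrow> 'a set) \<Rightarrow> 'a set" where
  "zer A = {x. 0 \<in> A x}"

definition inverse_op :: "('a \<Rightarrow> 'a set) \<Rightarrow> 'a \<Rightarrow> 'a set" where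
  "inverse_op T y = {x. y \<in> T x}"

definition resolvent_op :: "real \<Rightarrow> ('a::real_vector \<Rightarrow> 'a set) \<Rightarrow> 'a \<Rightarrow> 'a set" where
  "resolvent_op c A = inverse_op (\<lambda>x. {x + c *\<^sub>R w | w. w \<in> A x})"

(* The set-valued resolvent read as a point-valued map. By Minty's theorem, if c > 0 and A is
   maximally monotone on a real Hilbert space, then resolvent_op c A x is a singleton for every x;
   otherwise the value of the_elem may be unspecified. *)
definition resolvent :: "real \<Rightarrow> ('a::real_vector \<Rightarrow> 'a set) \<Rightarrow> 'a \<Rightarrow> 'a" where
  "resolvent c A x = the_elem (resolvent_op c A x)"

definition weakly_converges_to :: "(nat \<Rightarrow> 'a::real_inner) \<Rightarrow> 'a \<Rightarrow> bool" where
  "weakly_converges_to x z \<longleftrightarrow> (\<forall>y. (\<lambda>k. inner (x k) y) \<longlonglongrightarrow> inner z y)"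

end

theory Submission
  imports Defs
begin

text \<open>Write \<open>d\<^sub>k = x\<^sub>k - J\<^sub>k x\<^sub>k\<close> for the residual of the resolvent \<open>J\<^sub>k\<close> with parameter \<open>c\<^sub>k\<close>.
  Since \<open>\<beta>\<^sub>k + \<gamma>\<^sub>k\<close> tends to 1 with summable defect, the iteration is
  \<open>x\<^sub>k - \<gamma>\<^sub>k d\<^sub>k\<close> up to summable errors, and for a zero \<open>z\<close> of \<open>A\<close> firm nonexpansiveness gives
  \<open>\<parallel>d\<^sub>k\<parallel>\<^sup>2 \<le> \<langle>x\<^sub>k - z, d\<^sub>k\<rangle>\<close>. Two estimates follow (\<open>perturbed_iteration\<close>): the distance from \<open>x\<^sub>k\<close>
  to each zero of \<open>A\<close> converges, and the squared residuals weighted by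
  \<open>\<gamma>\<^sub>k (2\<beta>\<^sub>k + \<gamma>\<^sub>k)\<close> are summable as soon as these weights and the products
  \<open>\<gamma>\<^sub>k (\<beta>\<^sub>k + \<gamma>\<^sub>k)\<close> are eventually nonnegative.

  The four alternatives are four ways to deduce \<open>d\<^sub>k \<longlonglongrightarrow> 0\<close>. In the first three the weights are
  eventually bounded below by a positive constant: if \<open>\<gamma>\<^sub>k \<longlonglongrightarrow> 1\<close> they tend to 1, and if
  \<open>1 - \<beta>\<^sub>k - \<gamma>\<^sub>k/2\<close> stays inside \<open>(0, 1)\<close>, then, because \<open>\<beta>\<^sub>k \<approx> 1 - \<gamma>\<^sub>k\<close>, the
  parameter \<open>\<gamma>\<^sub>k\<close> stays inside \<open>(0, 2)\<close> and the weight is close to \<open>\<gamma>\<^sub>k (2 - \<gamma>\<^sub>k)\<close>. In the fourth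
  the weights have infinite sum, which forces a subsequence of residuals to 0; the whole sequence
  follows because \<open>\<parallel>d\<^sub>k\<parallel>\<close> is decreasing up to a summable error
  (\<open>resolvent_residual_convergent\<close>), which is where the summability of the variation of \<open>c\<close> enters.

  As \<open>c\<^sub>k\<close> is bounded below by some \<open>m > 0\<close>, vanishing residuals make \<open>x\<close> an approximate fixed point
  sequence of the single resolvent with parameter \<open>m\<close>, whose fixed points are the zeros of \<open>A\<close>, and
  Opial's principle (\<open>weak_convergence_to_fixed_point\<close>) yields the weak limit.

  Both Minty's theorem and Opial's principle are derived from one elementary fact
  (\<open>strongly_convex_minimum\<close>): in a complete inner product space a family of upper bounds that is bounded below and
  strongly convex has a minimiser, with quadratic growth around it. For Minty's theorem the minimum
  produces the point that extends a monotone graph; for Opial's principle it produces the asymptotic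
  centre of a sequence, which takes over the part that weak compactness usually plays.\<close>

section \<open>Minimisation by strong convexity\<close>

lemma norm_convex_combination:
  fixes y y' :: "'a::real_inner"
  shows "(norm ((1 - s) *\<^sub>R y + s *\<^sub>R y'))\<^sup>2 =
    (1 - s) * (norm y)\<^sup>2 + s * (norm y')\<^sup>2 - s * (1 - s) * (norm (y - y'))\<^sup>2"
  unfolding power2_norm_eq_inner
  by (simp add: inner_simps inner_commute algebra_simps)

text \<open>A set \<open>\<Phi>\<close> of pairs \<open>(y, r)\<close> is read as a collection of statements ``the value at \<open>y\<close> is at most
  \<open>r\<close>'', so that it stands for the epigraph of a function without that function, possibly a supremum
  or an upper limit, having to be defined. Closure under combinations with the gain
  \<open>s (1 - s) \<parallel>y - y'\<parallel>\<^sup>2\<close> is strong convexity with modulus 2; it makes minimising sequences Cauchy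
  and gives the quadratic growth with the sharp constant 1, on which both applications rely.\<close>

lemma strongly_convex_minimum:
  fixes \<Phi> :: "('a::{real_inner, complete_space} \<times> real) set"
  assumes nonempty: "\<Phi> \<noteq> {}"
    and bound: "\<And>y r. (y, r) \<in> \<Phi> \<Longrightarrow> m \<le> r"
    and combine: "\<And>y r y' r' s. (y, r) \<in> \<Phi> \<Longrightarrow> (y', r') \<in> \<Phi> \<Longrightarrow> 0 < s \<Longrightarrow> s < 1 \<Longrightarrow>
      ((1 - s) *\<^sub>R y + s *\<^sub>R y', (1 - s) * r + s * r' - s * (1 - s) * (norm (y - y'))\<^sup>2) \<in> \<Phi>"
  obtains z \<rho> where "m \<le> \<rho>"
    and "\<And>y r. (y, r) \<in> \<Phi> \<Longrightarrow> \<rho> + (norm (y - z))\<^sup>2 \<le> r"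
    and "\<And>\<epsilon>. 0 < \<epsilon> \<Longrightarrow> \<exists>y r. (y, r) \<in> \<Phi> \<and> r < \<rho> + \<epsilon>"
proof -
  define \<rho> where "\<rho> = Inf (snd ` \<Phi>)"
  have bdd: "bdd_below (snd ` \<Phi>)"
    using bound by (auto intro!: bdd_belowI[of _ m])
  have m: "m \<le> \<rho>"
    unfolding \<rho>_def using nonempty bound by (intro cInf_greatest) auto
  have low: "\<rho> \<le> r" if "(y, r) \<in> \<Phi>" for y r
    unfolding \<rho>_def using bdd that by (force intro: cInf_lower)
  have approx: "\<exists>y r. (y, r) \<in> \<Phi> \<and> r < \<rho> + \<epsilon>" if "0 < \<epsilon>" for \<epsilon>
    using cInf_lessD[of "snd ` \<Phi>" "\<rho> + \<epsilon>"] nonempty that unfolding \<rho>_def by force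
  have "\<forall>n. \<exists>p. p \<in> \<Phi> \<and> snd p < \<rho> + inverse (real (Suc n))"
    using approx by (metis inverse_positive_iff_positive of_nat_0_less_iff snd_conv zero_less_Suc)
  then obtain P where P: "\<And>n. P n \<in> \<Phi>" "\<And>n. snd (P n) < \<rho> + inverse (real (Suc n))"
    by metis
  define Y where "Y = (\<lambda>n. fst (P n))"
  define R where "R = (\<lambda>n. snd (P n))"
  have YR: "(Y n, R n) \<in> \<Phi>" for n
    using P(1) by (simp add: Y_def R_def)
  have R_lim: "R \<longlonglongrightarrow> \<rho>"
  proof (rule tendsto_sandwich[OF _ _ tendsto_const])
    show "\<forall>\<^sub>F n in sequentially. \<rho> \<le> R n"
      using low YR by (auto intro: always_eventually)
    show "\<forall>\<^sub>F n in sequentially. R n \<le> \<rho> + inverse (real (Suc n))"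
      using P(2) by (auto intro!: always_eventually less_imp_le simp: R_def)
    show "(\<lambda>n. \<rho> + inverse (real (Suc n))) \<longlonglongrightarrow> \<rho>"
      using tendsto_add[OF tendsto_const LIMSEQ_inverse_real_of_nat, of \<rho>] by simp
  qed
  have gap: "(norm (Y i - Y j))\<^sup>2 \<le> 2 * (R i - \<rho>) + 2 * (R j - \<rho>)" for i j
    using low[OF combine[OF YR[of i] YR[of j], of "1/2"]] by (simp add: field_simps)
  have "Cauchy Y"
  proof (rule metric_CauchyI)
    fix \<epsilon> :: real assume \<epsilon>: "0 < \<epsilon>"
    then have "\<forall>\<^sub>F n in sequentially. R n < \<rho> + \<epsilon>\<^sup>2 / 4"
      by (intro order_tendstoD(2)[OF R_lim]) simp
    then obtain N where N: "\<And>n. N \<le> n \<Longrightarrow> R n < \<rho> + \<epsilon>\<^sup>2 / 4"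
      by (auto simp: eventually_sequentially)
    have "dist (Y i) (Y j) < \<epsilon>" if "N \<le> i" "N \<le> j" for i j
    proof -
      have "(norm (Y i - Y j))\<^sup>2 < \<epsilon>\<^sup>2"
        using gap[of i j] N[OF that(1)] N[OF that(2)] by (simp add: field_simps)
      then show ?thesis
        using \<epsilon> power2_less_imp_less[of "norm (Y i - Y j)" \<epsilon>] by (simp add: dist_norm)
    qed
    then show "\<exists>N. \<forall>i\<ge>N. \<forall>j\<ge>N. dist (Y i) (Y j) < \<epsilon>"
      by blast
  qed
  then obtain z where z: "Y \<longlonglongrightarrow> z"
    using Cauchy_convergent convergent_def by blast
  \<comment> \<open>Midpoints would only give growth constant 1/2; moving a fraction \<open>s\<close> from the minimising
    sequence towards \<open>y\<close> and letting \<open>s\<close> tend to 0 gives the constant 1.\<close>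
  have "\<rho> + (norm (y - z))\<^sup>2 \<le> r" if yr: "(y, r) \<in> \<Phi>" for y r
  proof -
    have s: "\<rho> + (1 - s) * (norm (z - y))\<^sup>2 \<le> r" if s: "0 < s" "s < 1" for s
    proof -
      have "(\<lambda>n. (1 - s) * R n + s * r - s * (1 - s) * (norm (Y n - y))\<^sup>2)
          \<longlonglongrightarrow> (1 - s) * \<rho> + s * r - s * (1 - s) * (norm (z - y))\<^sup>2"
        by (intro tendsto_intros R_lim z)
      then have "\<rho> \<le> (1 - s) * \<rho> + s * r - s * (1 - s) * (norm (z - y))\<^sup>2"
        using low[OF combine[OF YR yr s]] by (intro LIMSEQ_le_const) auto
      then have "s * (\<rho> + (1 - s) * (norm (z - y))\<^sup>2) \<le> s * r"
        by (simp add: algebra_simps)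
      then show ?thesis
        using s by simp
    qed
    have "((\<lambda>s. \<rho> + (1 - s) * (norm (z - y))\<^sup>2) \<longlongrightarrow> \<rho> + (1 - 0) * (norm (z - y))\<^sup>2)
        (at_right (0::real))"
      by (intro tendsto_intros)
    moreover have "\<forall>\<^sub>F s in at_right (0::real). \<rho> + (1 - s) * (norm (z - y))\<^sup>2 \<le> r"
      using s by (auto simp: eventually_at_right_field intro!: exI[of _ 1])
    ultimately have "\<rho> + (1 - 0) * (norm (z - y))\<^sup>2 \<le> r"
      by (intro tendsto_upperbound) auto
    then show ?thesis
      by (simp add: norm_minus_commute)
  qed
  then show thesis
    using that m approx by blast
qed

section \<open>Resolvents of maximally monotone operators\<close>

text \<open>Although \<open>(p, q) \<mapsto> \<langle>p, q\<rangle>\<close> is not convex, its epigraph contains the convex hull of the points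
  \<open>(a, b, \<langle>a, b\<rangle>)\<close> over a monotone graph. Monotonicity says that any two points \<open>(a, b, r)\<close> and \<open>(a', b', r')\<close> over the
  graph satisfy \<open>r + r' \<ge> \<langle>a, b'\<rangle> + \<langle>a', b\<rangle>\<close>. With one of the points fixed this is a half-space
  condition on the other, so it passes to the hull in each point in turn; taking both points equal
  to \<open>(p, q, r)\<close> gives the claim.\<close>

lemma convex_hull_graph_above_pairing:
  fixes G :: "('a::real_inner \<times> 'a) set"
  assumes mono: "\<And>a b a' b'. (a, b) \<in> G \<Longrightarrow> (a', b') \<in> G \<Longrightarrow> 0 \<le> inner (a - a') (b - b')"
    and mem: "(p, q, r) \<in> convex hull ((\<lambda>(a, b). (a, b, inner a b)) ` G)"
  shows "inner p q \<le> r"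
proof -
  let ?S = "(\<lambda>(a, b). (a, b, inner a b)) ` G"
  have half: "convex {(a, b, t). 0 \<le> r' + t - inner p' b - inner a q'}"
    for p' q' :: 'a and r' :: real
  proof -
    have "{(a, b, t). 0 \<le> r' + t - inner p' b - inner a q'} = {w. inner (q', p', - 1) w \<le> r'}"
      by (auto simp: inner_commute)
    then show ?thesis
      by (simp only: convex_halfspace_le)
  qed
  have one: "0 \<le> inner a b + r - inner a q - inner p b" if ab: "(a, b) \<in> G" for a b
  proof -
    have "0 \<le> inner a b + inner a' b' - inner a b' - inner a' b" if "(a', b') \<in> G" for a' b'
      using mono[OF ab that] by (simp add: inner_diff_left inner_diff_right)
    then have "?S \<subseteq> {(a', b', t). 0 \<le> inner a b + t - inner a b' - inner a' b}"
      by auto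
    from subsetD[OF hull_minimal[of _ _ convex, OF this half] mem] show ?thesis
      by simp
  qed
  have "0 \<le> r + inner a b - inner p b - inner a q" if "(a, b) \<in> G" for a b
    using one[OF that] by simp
  then have "?S \<subseteq> {(a, b, t). 0 \<le> r + t - inner p b - inner a q}"
    by auto
  then have "(p, q, r) \<in> {(a, b, t). 0 \<le> r + t - inner p b - inner a q}"
    using subsetD[OF hull_minimal[of _ _ convex, OF _ half] mem] by blast
  then show ?thesis
    by simp
qed

text \<open>The condition on \<open>x\<close> for one pair \<open>(a, b)\<close> is \<open>\<parallel>x\<parallel>\<^sup>2 + \<langle>x, b - a\<rangle> - \<langle>a, b\<rangle> \<le> 0\<close>. Convex
  combinations of the left-hand sides are \<open>\<parallel>x\<parallel>\<^sup>2 + \<langle>x, q - p\<rangle> - r\<close> with \<open>(p, q, r)\<close> in the hull of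
  the graph lifted by the pairing, and their minimum over \<open>x\<close>, attained at \<open>-(q - p)/2\<close>, is
  \<open>- (\<parallel>(q - p)/2\<parallel>\<^sup>2 + r)\<close>. Making this dual value as large as possible is a strongly convex
  minimisation. It is never positive because
  \<open>\<parallel>(q - p)/2\<parallel>\<^sup>2 + \<langle>p, q\<rangle> = \<parallel>(p + q)/2\<parallel>\<^sup>2\<close>, and the quadratic growth around the optimum is exactly
  the family of conditions on \<open>x\<close>.\<close>

lemma monotone_graph_extension:
  fixes G :: "('a::{real_inner, complete_space} \<times> 'a) set"
  assumes nonempty: "G \<noteq> {}"
    and mono: "\<And>a b a' b'. (a, b) \<in> G \<Longrightarrow> (a', b') \<in> G \<Longrightarrow> 0 \<le> inner (a - a') (b - b')"
  obtains x where "\<And>a b. (a, b) \<in> G \<Longrightarrow> 0 \<le> inner (x - a) (- x - b)"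
proof -
  define H where "H = convex hull ((\<lambda>(a, b). (a, b, inner a b)) ` G)"
  define \<Phi> where "\<Phi> = (\<lambda>(p, q, r). ((1/2) *\<^sub>R (q - p), (norm ((1/2) *\<^sub>R (q - p)))\<^sup>2 + r)) ` H"
  have memG: "((1/2) *\<^sub>R (b - a), (norm ((1/2) *\<^sub>R (b - a)))\<^sup>2 + inner a b) \<in> \<Phi>"
    if "(a, b) \<in> G" for a b
  proof -
    have "(a, b, inner a b) \<in> H"
      unfolding H_def using that by (intro hull_inc) force
    then show ?thesis
      unfolding \<Phi>_def by force
  qed
  obtain z \<rho> where \<rho>: "0 \<le> \<rho>" and z: "\<And>y r. (y, r) \<in> \<Phi> \<Longrightarrow> \<rho> + (norm (y - z))\<^sup>2 \<le> r"
  proof (rule strongly_convex_minimum[of \<Phi> 0])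
    show "\<Phi> \<noteq> {}"
      using nonempty memG by fastforce
  next
    fix y r assume "(y, r) \<in> \<Phi>"
    then obtain p q t where H: "(p, q, t) \<in> H"
      and r: "r = (norm ((1/2) *\<^sub>R (q - p)))\<^sup>2 + t"
      unfolding \<Phi>_def by auto
    have "inner p q \<le> t"
      using convex_hull_graph_above_pairing[OF mono] H unfolding H_def by blast
    moreover have "(norm ((1/2) *\<^sub>R (q - p)))\<^sup>2 + inner p q = (norm ((1/2) *\<^sub>R (p + q)))\<^sup>2"
      unfolding power2_norm_eq_inner by (simp add: inner_simps inner_commute field_simps)
    ultimately show "0 \<le> r"
      using r by (smt (verit) zero_le_power2)
  next
    fix y r y' r' and s :: real
    assume "(y, r) \<in> \<Phi>" "(y', r') \<in> \<Phi>" and s: "0 < s" "s < 1"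
    then obtain p q t p' q' t' where H: "(p, q, t) \<in> H" "(p', q', t') \<in> H"
      and y: "y = (1/2) *\<^sub>R (q - p)" "y' = (1/2) *\<^sub>R (q' - p')"
      and r: "r = (norm y)\<^sup>2 + t" "r' = (norm y')\<^sup>2 + t'"
      unfolding \<Phi>_def by auto
    have "(1 - s) *\<^sub>R (p, q, t) + s *\<^sub>R (p', q', t') \<in> H"
      using H s unfolding H_def by (intro convexD convex_convex_hull) auto
    then have K: "((1 - s) *\<^sub>R p + s *\<^sub>R p', (1 - s) *\<^sub>R q + s *\<^sub>R q', (1 - s) * t + s * t') \<in> H"
      by simp
    have eq: "(1/2) *\<^sub>R (((1 - s) *\<^sub>R q + s *\<^sub>R q') - ((1 - s) *\<^sub>R p + s *\<^sub>R p'))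
        = (1 - s) *\<^sub>R y + s *\<^sub>R y'"
      unfolding y by (simp add: scaleR_add_right scaleR_diff_right mult.commute add_diff_add)
    have "((1 - s) *\<^sub>R y + s *\<^sub>R y',
        (norm ((1 - s) *\<^sub>R y + s *\<^sub>R y'))\<^sup>2 + ((1 - s) * t + s * t')) \<in> \<Phi>"
      unfolding \<Phi>_def by (rule image_eqI[OF _ K]) (simp only: prod.case eq)
    moreover have "(norm ((1 - s) *\<^sub>R y + s *\<^sub>R y'))\<^sup>2 + ((1 - s) * t + s * t')
        = (1 - s) * r + s * r' - s * (1 - s) * (norm (y - y'))\<^sup>2"
      unfolding norm_convex_combination r by (simp add: algebra_simps)
    ultimately show "((1 - s) *\<^sub>R y + s *\<^sub>R y',
        (1 - s) * r + s * r' - s * (1 - s) * (norm (y - y'))\<^sup>2) \<in> \<Phi>"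
      by simp
  qed blast
  have "0 \<le> inner (- z - a) (- (- z) - b)" if "(a, b) \<in> G" for a b
  proof -
    have "(norm ((1/2) *\<^sub>R (b - a) - z))\<^sup>2 \<le> (norm ((1/2) *\<^sub>R (b - a)))\<^sup>2 + inner a b"
      using z[OF memG[OF that]] \<rho> by linarith
    then show ?thesis
      unfolding power2_norm_eq_inner by (simp add: inner_simps inner_commute field_simps)
  qed
  then show thesis
    using that by blast
qed

lemma maximally_monotoneD:
  assumes "maximally_monotone A" "w \<in> A x" "v \<in> A y"
  shows "0 \<le> inner (x - y) (w - v)"
  using assms unfolding maximally_monotone_def monotone_op_def graph_op_def by blast

lemma maximally_monotone_memI:
  assumes max: "maximally_monotone A"
    and rel: "\<And>y v. v \<in> A y \<Longrightarrow> 0 \<le> inner (x - y) (w - v)"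
  shows "w \<in> A x"
proof (rule ccontr)
  assume new: "w \<notin> A x"
  define B where "B = A(x := insert w (A x))"
  have B: "graph_op B = insert (x, w) (graph_op A)"
    unfolding B_def graph_op_def by (auto split: if_splits)
  have sym: "0 \<le> inner (y - x) (v - w)" if "v \<in> A y" for y v
    using rel[OF that] by (metis inner_minus_left inner_minus_right minus_diff_eq minus_minus)
  have "monotone_op B"
    unfolding monotone_op_def B
    using rel sym maximally_monotoneD[OF max] by (auto simp: graph_op_def)
  moreover have "graph_op A \<subset> graph_op B"
    using new unfolding B by (auto simp: graph_op_def)
  ultimately show False
    using max unfolding maximally_monotone_def by blast
qed

text \<open>Maximality turns a point monotonically related to the whole graph into a point of the graph, so
  it suffices to extend the graph of \<open>c A\<close> translated by \<open>y\<close>.\<close>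

theorem Minty:
  fixes A :: "'a::{real_inner, complete_space} \<Rightarrow> 'a set"
  assumes max: "maximally_monotone A" and c: "0 < c"
  obtains p where "(1 / c) *\<^sub>R (y - p) \<in> A p"
proof -
  define G where "G = (\<lambda>(a, b). (a - y, c *\<^sub>R b)) ` graph_op A"
  have "graph_op A \<noteq> {}"
    using maximally_monotone_memI[OF max, of 0 0] by (auto simp: graph_op_def)
  then have "G \<noteq> {}"
    unfolding G_def by simp
  moreover have "0 \<le> inner (a - a') (b - b')" if "(a, b) \<in> G" "(a', b') \<in> G" for a b a' b'
    using that maximally_monotoneD[OF max] c unfolding G_def graph_op_def
    by (auto simp flip: scaleR_right_diff_distrib)
  ultimately obtain x where x: "\<And>a b. (a, b) \<in> G \<Longrightarrow> 0 \<le> inner (x - a) (- x - b)"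
    using monotone_graph_extension by blast
  have "(1 / c) *\<^sub>R (y - (x + y)) \<in> A (x + y)"
  proof (rule maximally_monotone_memI[OF max])
    fix a b assume "b \<in> A a"
    then have "(a - y, c *\<^sub>R b) \<in> G"
      unfolding G_def graph_op_def by force
    from x[OF this] have "0 \<le> (1 / c) * inner (x - (a - y)) (- x - c *\<^sub>R b)"
      using c by simp
    also have "\<dots> = inner (x + y - a) ((1 / c) *\<^sub>R (y - (x + y)) - b)"
      using c by (simp add: inner_simps field_simps)
    finally show "0 \<le> inner (x + y - a) ((1 / c) *\<^sub>R (y - (x + y)) - b)" .
  qed
  then show thesis
    using that by blast
qed

lemma resolvent_monotone:
  assumes max: "maximally_monotone A"
    and p: "(1 / c) *\<^sub>R (x - p) \<in> A p" and q: "(1 / c') *\<^sub>R (y - q) \<in> A q"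
    and c: "0 < c" "0 < c'"
  shows "0 \<le> inner (p - q) (c' *\<^sub>R (x - p) - c *\<^sub>R (y - q))"
proof -
  have "0 \<le> c * c' * inner (p - q) ((1 / c) *\<^sub>R (x - p) - (1 / c') *\<^sub>R (y - q))"
    using maximally_monotoneD[OF max p q] c by simp
  also have "\<dots> = inner (p - q) (c' *\<^sub>R (x - p) - c *\<^sub>R (y - q))"
    using c by (simp add: inner_diff_right right_diff_distrib)
  finally show ?thesis .
qed

lemma resolvent_mem:
  fixes A :: "'a::{real_inner, complete_space} \<Rightarrow> 'a set"
  assumes max: "maximally_monotone A" and c: "0 < c"
  shows "(1 / c) *\<^sub>R (x - resolvent c A x) \<in> A (resolvent c A x)"
    and "(1 / c) *\<^sub>R (x - p) \<in> A p \<Longrightarrow> resolvent c A x = p"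
proof -
  have mem: "p \<in> resolvent_op c A x \<longleftrightarrow> (1 / c) *\<^sub>R (x - p) \<in> A p" for p
  proof
    assume "p \<in> resolvent_op c A x"
    then show "(1 / c) *\<^sub>R (x - p) \<in> A p"
      using c unfolding resolvent_op_def inverse_op_def by auto
  next
    assume "(1 / c) *\<^sub>R (x - p) \<in> A p"
    moreover have "x = p + c *\<^sub>R ((1 / c) *\<^sub>R (x - p))"
      using c by simp
    ultimately show "p \<in> resolvent_op c A x"
      unfolding resolvent_op_def inverse_op_def by blast
  qed
  have uniq: "p = q" if "(1 / c) *\<^sub>R (x - p) \<in> A p" "(1 / c) *\<^sub>R (x - q) \<in> A q" for p q
  proof -
    have "0 \<le> inner (p - q) (c *\<^sub>R (x - p) - c *\<^sub>R (x - q))"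
      using resolvent_monotone[OF max that c c] .
    also have "\<dots> = - c * (norm (p - q))\<^sup>2"
      unfolding power2_norm_eq_inner by (simp add: inner_simps inner_commute algebra_simps)
    finally have "(norm (p - q))\<^sup>2 \<le> 0"
      using c by (simp add: mult_le_0_iff)
    then show ?thesis
      by simp
  qed
  obtain p where p: "(1 / c) *\<^sub>R (x - p) \<in> A p"
    using Minty[OF max c] by blast
  have "resolvent_op c A x = {q}" if "(1 / c) *\<^sub>R (x - q) \<in> A q" for q
    using that uniq mem by blast
  then have R: "resolvent c A x = q" if "(1 / c) *\<^sub>R (x - q) \<in> A q" for q
    using that unfolding resolvent_def by simp
  show "(1 / c) *\<^sub>R (x - resolvent c A x) \<in> A (resolvent c A x)"
    using R[OF p] p by simp
  show "resolvent c A x = p" if "(1 / c) *\<^sub>R (x - p) \<in> A p" for p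
    using R[OF that] .
qed

lemma resolvent_fixed_iff:
  fixes A :: "'a::{real_inner, complete_space} \<Rightarrow> 'a set"
  assumes "maximally_monotone A" and "0 < c"
  shows "resolvent c A z = z \<longleftrightarrow> z \<in> zer A"
  using resolvent_mem(1)[OF assms, of z] resolvent_mem(2)[OF assms, of z z] by (auto simp: zer_def)

lemma resolvent_firmly_nonexpansive:
  fixes A :: "'a::{real_inner, complete_space} \<Rightarrow> 'a set"
  assumes max: "maximally_monotone A" and c: "0 < c"
  shows "(norm ((x - resolvent c A x) - (y - resolvent c A y)))\<^sup>2
    \<le> inner (x - y) ((x - resolvent c A x) - (y - resolvent c A y))"
proof -
  let ?p = "resolvent c A x" and ?q = "resolvent c A y"
  have "0 \<le> c * inner (?p - ?q) ((x - ?p) - (y - ?q))"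
    using resolvent_monotone[OF max resolvent_mem(1)[OF max c] resolvent_mem(1)[OF max c] c c, of x y]
    by (simp add: inner_diff_right right_diff_distrib)
  then have "0 \<le> inner (?p - ?q) ((x - ?p) - (y - ?q))"
    using c by (simp add: zero_le_mult_iff)
  then show ?thesis
    unfolding power2_norm_eq_inner by (simp add: inner_simps inner_commute algebra_simps)
qed

lemma resolvent_step_cocoercive:
  fixes A :: "'a::{real_inner, complete_space} \<Rightarrow> 'a set"
  assumes "maximally_monotone A" and "0 < c" and "z \<in> zer A"
  shows "(norm (x - resolvent c A x))\<^sup>2 \<le> inner (x - z) (x - resolvent c A x)"
  using resolvent_firmly_nonexpansive[OF assms(1,2), of x z] resolvent_fixed_iff[OF assms(1,2), of z]
    assms(3) by simp

text \<open>The vector \<open>d\<close> plays the part of a residual \<open>y - p\<close>, and \<open>y - 2 d\<close> is the reflected point \<open>2 p - y\<close>: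
  firm nonexpansiveness is nonexpansiveness of the reflection.\<close>

lemma reflection_norm_le:
  fixes y d :: "'a::real_inner"
  assumes "(norm d)\<^sup>2 \<le> inner y d"
  shows "norm (y - 2 *\<^sub>R d) \<le> norm y"
proof -
  have "(norm (y - 2 *\<^sub>R d))\<^sup>2 = (norm y)\<^sup>2 - 4 * (inner y d - (norm d)\<^sup>2)"
    unfolding power2_norm_eq_inner by (simp add: inner_simps inner_commute algebra_simps)
  then have "(norm (y - 2 *\<^sub>R d))\<^sup>2 \<le> (norm y)\<^sup>2"
    using assms by simp
  then show ?thesis
    by (rule power2_le_imp_le) simp
qed

lemma resolvent_nonexpansive:
  fixes A :: "'a::{real_inner, complete_space} \<Rightarrow> 'a set"
  assumes max: "maximally_monotone A" and c: "0 < c"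
  shows "norm (resolvent c A x - resolvent c A y) \<le> norm (x - y)"
proof -
  let ?d = "(x - resolvent c A x) - (y - resolvent c A y)"
  have "norm ((x - y) - 2 *\<^sub>R ?d) \<le> norm (x - y)"
    by (rule reflection_norm_le[OF resolvent_firmly_nonexpansive[OF max c]])
  then have "norm ((x - y) + ((x - y) - 2 *\<^sub>R ?d)) \<le> 2 * norm (x - y)"
    using norm_triangle_ineq[of "x - y" "(x - y) - 2 *\<^sub>R ?d"] by linarith
  moreover have "(x - y) + ((x - y) - 2 *\<^sub>R ?d) = 2 *\<^sub>R (resolvent c A x - resolvent c A y)"
    by (simp add: algebra_simps scaleR_2)
  ultimately show ?thesis
    by simp
qed

text \<open>For \<open>c' \<le> c\<close> the factor is at most 2, which passes from varying parameters to a fixed smaller one;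
  for \<open>c'\<close> close to \<open>c\<close> it is close to 1, which controls the drift of residuals along a slowly varying
  sequence of parameters.\<close>

lemma resolvent_parameter_change:
  fixes A :: "'a::{real_inner, complete_space} \<Rightarrow> 'a set"
  assumes max: "maximally_monotone A" and c: "0 < c" "0 < c'"
  shows "norm (x - resolvent c' A x) \<le> (1 + \<bar>1 - c' / c\<bar>) * norm (x - resolvent c A x)"
proof -
  let ?p = "resolvent c A x" and ?q = "resolvent c' A x"
  have "0 \<le> inner (?p - ?q) (c' *\<^sub>R (x - ?p) - c *\<^sub>R (x - ?q))"
    using resolvent_monotone[OF max resolvent_mem(1)[OF max c(1)] resolvent_mem(1)[OF max c(2)] c] .
  also have "c' *\<^sub>R (x - ?p) - c *\<^sub>R (x - ?q) = (c' - c) *\<^sub>R (x - ?p) - c *\<^sub>R (?p - ?q)"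
    by (simp add: algebra_simps)
  finally have "c * (norm (?p - ?q))\<^sup>2 \<le> (c' - c) * inner (?p - ?q) (x - ?p)"
    by (simp add: inner_diff_right power2_norm_eq_inner)
  also have "\<dots> \<le> \<bar>c' - c\<bar> * (norm (?p - ?q) * norm (x - ?p))"
    using mult_left_mono[OF Cauchy_Schwarz_ineq2[of "?p - ?q" "x - ?p"], of "\<bar>c' - c\<bar>"]
      abs_ge_self[of "(c' - c) * inner (?p - ?q) (x - ?p)"] by (simp add: abs_mult)
  finally have "c * norm (?p - ?q) * norm (?p - ?q)
      \<le> \<bar>c' - c\<bar> * norm (x - ?p) * norm (?p - ?q)"
    by (simp add: power2_eq_square mult_ac)
  then have "c * norm (?p - ?q) \<le> \<bar>c' - c\<bar> * norm (x - ?p)"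
    using c by (cases "?p = ?q") (auto simp: mult_le_cancel_right)
  moreover have "\<bar>1 - c' / c\<bar> = \<bar>c' - c\<bar> / c"
  proof -
    have "1 - c' / c = (c - c') / c"
      using c by (simp add: field_simps)
    then show ?thesis
      using c by (simp add: abs_divide abs_minus_commute)
  qed
  ultimately have "norm (?p - ?q) \<le> \<bar>1 - c' / c\<bar> * norm (x - ?p)"
    using c by (simp add: field_simps)
  moreover have "norm (x - ?q) \<le> norm (x - ?p) + norm (?p - ?q)"
    using norm_triangle_ineq[of "x - ?p" "?p - ?q"] by simp
  ultimately show ?thesis
    by (simp add: algebra_simps)
qed

section \<open>Asymptotic centres and weak convergence\<close>

text \<open>The pair \<open>(z, \<rho>)\<close> consists of the minimiser and the minimum of
  \<open>y \<mapsto> limsup\<^sub>F \<parallel>x - y\<parallel>\<^sup>2\<close>; the upper limit is expressed through its eventual upper bounds. The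
  second clause includes the quadratic growth around the minimiser. A filter instead of a sequence
  lets subsequences, and sets of indices that occur infinitely often, be treated alike.\<close>

definition asymptotic_centre :: "'b filter \<Rightarrow> ('b \<Rightarrow> 'a::real_inner) \<Rightarrow> 'a \<Rightarrow> real \<Rightarrow> bool" where
  "asymptotic_centre F x z \<rho> \<longleftrightarrow>
     (\<forall>\<epsilon>>0. \<forall>\<^sub>F k in F. (norm (x k - z))\<^sup>2 \<le> \<rho> + \<epsilon>) \<and>
     (\<forall>y r. (\<forall>\<^sub>F k in F. (norm (x k - y))\<^sup>2 \<le> r) \<longrightarrow> \<rho> + (norm (y - z))\<^sup>2 \<le> r)"

lemma asymptotic_centre_exists:
  fixes x :: "'b \<Rightarrow> 'a::{real_inner, complete_space}"
  assumes F: "F \<noteq> bot" and bounded: "\<forall>\<^sub>F k in F. norm (x k) \<le> M"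
  obtains z \<rho> where "asymptotic_centre F x z \<rho>"
proof -
  define \<Phi> where "\<Phi> = {(y, r). \<forall>\<^sub>F k in F. (norm (x k - y))\<^sup>2 \<le> r}"
  obtain z \<rho> where \<rho>: "0 \<le> \<rho>"
    and z: "\<And>y r. (y, r) \<in> \<Phi> \<Longrightarrow> \<rho> + (norm (y - z))\<^sup>2 \<le> r"
    and approx: "\<And>\<epsilon>. 0 < \<epsilon> \<Longrightarrow> \<exists>y r. (y, r) \<in> \<Phi> \<and> r < \<rho> + \<epsilon>"
  proof (rule strongly_convex_minimum[of \<Phi> 0])
    have "\<forall>\<^sub>F k in F. (norm (x k - 0))\<^sup>2 \<le> M\<^sup>2"
      using bounded by eventually_elim (simp add: power_mono)
    then show "\<Phi> \<noteq> {}"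
      unfolding \<Phi>_def by blast
  next
    fix y r assume "(y, r) \<in> \<Phi>"
    then have "\<forall>\<^sub>F k in F. (norm (x k - y))\<^sup>2 \<le> r"
      unfolding \<Phi>_def by simp
    then have "\<forall>\<^sub>F k in F. 0 \<le> r"
      by eventually_elim (meson order_trans zero_le_power2)
    then show "0 \<le> r"
      using F by simp
  next
    fix y r y' r' and s :: real
    assume "(y, r) \<in> \<Phi>" "(y', r') \<in> \<Phi>" and s: "0 < s" "s < 1"
    then have "\<forall>\<^sub>F k in F. (norm (x k - y))\<^sup>2 \<le> r" "\<forall>\<^sub>F k in F. (norm (x k - y'))\<^sup>2 \<le> r'"
      unfolding \<Phi>_def by auto
    then have "\<forall>\<^sub>F k in F. (norm (x k - ((1 - s) *\<^sub>R y + s *\<^sub>R y')))\<^sup>2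
        \<le> (1 - s) * r + s * r' - s * (1 - s) * (norm (y - y'))\<^sup>2"
    proof eventually_elim
      case (elim k)
      have "x k - ((1 - s) *\<^sub>R y + s *\<^sub>R y') = (1 - s) *\<^sub>R (x k - y) + s *\<^sub>R (x k - y')"
        by (simp add: algebra_simps)
      moreover have "norm ((x k - y) - (x k - y')) = norm (y - y')"
        by (simp add: norm_minus_commute)
      moreover have "(1 - s) * (norm (x k - y))\<^sup>2 + s * (norm (x k - y'))\<^sup>2 \<le> (1 - s) * r + s * r'"
        using elim s by (intro add_mono mult_left_mono) auto
      ultimately show ?case
        by (simp add: norm_convex_combination)
    qed
    then show "((1 - s) *\<^sub>R y + s *\<^sub>R y', (1 - s) * r + s * r' - s * (1 - s) * (norm (y - y'))\<^sup>2) \<in> \<Phi>"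
      unfolding \<Phi>_def by simp
  qed blast
  \<comment> \<open>Near-minimisers \<open>y\<close> lie close to \<open>z\<close> by quadratic growth, so their bounds carry over to \<open>z\<close>.\<close>
  have "\<forall>\<^sub>F k in F. (norm (x k - z))\<^sup>2 \<le> \<rho> + \<epsilon>" if \<epsilon>: "0 < \<epsilon>" for \<epsilon>
  proof -
    define B where "B = sqrt (\<rho> + 1)"
    define \<sigma> where "\<sigma> = min 1 (\<epsilon> / (2 + 2 * B))"
    have B: "0 \<le> B"
      unfolding B_def using \<rho> by simp
    have \<sigma>: "0 < \<sigma>" "\<sigma> \<le> 1"
      using \<epsilon> B by (auto simp: \<sigma>_def)
    have "\<sigma> \<le> \<epsilon> / (2 + 2 * B)"
      by (simp add: \<sigma>_def)
    then have \<sigma>_small: "\<sigma> * (2 + 2 * B) \<le> \<epsilon>"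
      using B by (subst (asm) pos_le_divide_eq) auto
    have \<sigma>2: "\<sigma>\<^sup>2 \<le> \<sigma>"
      using mult_left_le[of \<sigma> \<sigma>] \<sigma> by (simp add: power2_eq_square)
    obtain y r where yr: "(y, r) \<in> \<Phi>" "r < \<rho> + \<sigma>\<^sup>2"
      using approx[of "\<sigma>\<^sup>2"] \<sigma>(1) by auto
    have "(norm (y - z))\<^sup>2 \<le> \<sigma>\<^sup>2"
      using z[OF yr(1)] yr(2) by linarith
    then have yz: "norm (y - z) \<le> \<sigma>"
      by (rule power2_le_imp_le) (use \<sigma>(1) in simp)
    have "\<forall>\<^sub>F k in F. (norm (x k - y))\<^sup>2 \<le> r"
      using yr(1) unfolding \<Phi>_def by simp
    then show ?thesis
    proof eventually_elim
      case (elim k)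
      have "norm (x k - y) \<le> B"
        unfolding B_def using elim yr(2) \<sigma>2 \<sigma>(2) by (intro real_le_rsqrt) linarith
      then have cross: "norm (x k - y) * norm (y - z) \<le> B * \<sigma>"
        using yz B by (intro mult_mono) auto
      have "norm (x k - z) \<le> norm (x k - y) + norm (y - z)"
        using norm_triangle_ineq[of "x k - y" "y - z"] by simp
      then have "(norm (x k - z))\<^sup>2 \<le> (norm (x k - y) + norm (y - z))\<^sup>2"
        by (intro power_mono) auto
      also have "\<dots> = (norm (x k - y))\<^sup>2 + 2 * (norm (x k - y) * norm (y - z)) + (norm (y - z))\<^sup>2"
        by (simp add: power2_sum)
      also have "\<dots> \<le> (\<rho> + \<sigma>\<^sup>2) + 2 * (B * \<sigma>) + \<sigma>\<^sup>2"
        using elim yr(2) cross \<open>(norm (y - z))\<^sup>2 \<le> \<sigma>\<^sup>2\<close> by linarith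
      also have "\<dots> \<le> \<rho> + \<sigma> * (2 + 2 * B)"
        using \<sigma>2 by (simp add: algebra_simps)
      finally show ?case
        using \<sigma>_small by linarith
    qed
  qed
  then show thesis
    using that z unfolding asymptotic_centre_def \<Phi>_def by blast
qed

lemma asymptotic_centre_least:
  assumes centre: "asymptotic_centre F x z \<rho>"
    and lim: "((\<lambda>k. norm (x k - y)) \<longlongrightarrow> b) F"
  shows "\<rho> + (norm (y - z))\<^sup>2 \<le> b\<^sup>2"
proof (rule field_le_epsilon)
  fix \<epsilon> :: real assume "0 < \<epsilon>"
  then have "\<forall>\<^sub>F k in F. (norm (x k - y))\<^sup>2 < b\<^sup>2 + \<epsilon>"
    by (intro order_tendstoD(2)[OF tendsto_power[OF lim]]) simp
  then have "\<forall>\<^sub>F k in F. (norm (x k - y))\<^sup>2 \<le> b\<^sup>2 + \<epsilon>"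
    by eventually_elim simp
  then show "\<rho> + (norm (y - z))\<^sup>2 \<le> b\<^sup>2 + \<epsilon>"
    using centre unfolding asymptotic_centre_def by blast
qed

lemma asymptotic_centre_radius:
  assumes F: "F \<noteq> bot" and centre: "asymptotic_centre F x z \<rho>"
    and lim: "((\<lambda>k. norm (x k - z)) \<longlongrightarrow> a) F"
  shows "\<rho> = a\<^sup>2"
proof (rule antisym)
  show "\<rho> \<le> a\<^sup>2"
    using asymptotic_centre_least[OF centre lim] by simp
  show "a\<^sup>2 \<le> \<rho>"
  proof (rule field_le_epsilon)
    fix \<epsilon> :: real assume "0 < \<epsilon>"
    then have "\<forall>\<^sub>F k in F. (norm (x k - z))\<^sup>2 \<le> \<rho> + \<epsilon>"
      using centre unfolding asymptotic_centre_def by blast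
    then show "a\<^sup>2 \<le> \<rho> + \<epsilon>"
      by (rule tendsto_upperbound[OF tendsto_power[OF lim] _ F])
  qed
qed

text \<open>\<open>T z\<close> is asymptotically no farther from \<open>x\<close> than \<open>z\<close>, since
  \<open>\<parallel>x\<^sub>k - T z\<parallel> \<le> \<parallel>x\<^sub>k - T x\<^sub>k\<parallel> + \<parallel>x\<^sub>k - z\<parallel>\<close>, and the minimiser is unique.\<close>

lemma asymptotic_centre_fixed:
  assumes centre: "asymptotic_centre F x z \<rho>"
    and nonexpansive: "\<And>u v. norm (T u - T v) \<le> norm (u - v)"
    and bounded: "\<forall>\<^sub>F k in F. norm (x k - z) \<le> M"
    and approx: "((\<lambda>k. norm (x k - T (x k))) \<longlongrightarrow> 0) F"
  shows "T z = z"
proof -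
  have "\<rho> + (norm (T z - z))\<^sup>2 \<le> \<rho> + \<epsilon>" if \<epsilon>: "0 < \<epsilon>" for \<epsilon> :: real
  proof -
    let ?t = "\<lambda>k. norm (x k - T (x k))"
    have "((\<lambda>k. 2 * \<bar>M\<bar> * ?t k + (?t k)\<^sup>2) \<longlongrightarrow> 2 * \<bar>M\<bar> * 0 + 0\<^sup>2) F"
      by (intro tendsto_intros approx)
    then have "\<forall>\<^sub>F k in F. 2 * \<bar>M\<bar> * ?t k + (?t k)\<^sup>2 < \<epsilon> / 2"
      using \<epsilon> by (intro order_tendstoD(2)) auto
    moreover have "\<forall>\<^sub>F k in F. (norm (x k - z))\<^sup>2 \<le> \<rho> + \<epsilon> / 2"
      using centre \<epsilon> half_gt_zero unfolding asymptotic_centre_def by blast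
    ultimately have "\<forall>\<^sub>F k in F. (norm (x k - T z))\<^sup>2 \<le> \<rho> + \<epsilon>"
      using bounded
    proof eventually_elim
      case (elim k)
      have cross: "norm (x k - z) * ?t k \<le> \<bar>M\<bar> * ?t k"
        using elim(3) by (intro mult_right_mono) auto
      have "norm (x k - T z) \<le> ?t k + norm (x k - z)"
        using norm_triangle_ineq[of "x k - T (x k)" "T (x k) - T z"] nonexpansive[of "x k" z] by simp
      then have "(norm (x k - T z))\<^sup>2 \<le> (?t k + norm (x k - z))\<^sup>2"
        by (intro power_mono) auto
      also have "\<dots> = (norm (x k - z))\<^sup>2 + 2 * (norm (x k - z) * ?t k) + (?t k)\<^sup>2"
        by (simp add: power2_sum)
      also have "\<dots> \<le> (\<rho> + \<epsilon> / 2) + 2 * (\<bar>M\<bar> * ?t k) + (?t k)\<^sup>2"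
        using elim(2) cross by linarith
      finally show ?case
        using elim by (simp add: algebra_simps)
    qed
    then show ?thesis
      using centre unfolding asymptotic_centre_def by blast
  qed
  then have "(norm (T z - z))\<^sup>2 \<le> 0"
    using field_le_epsilon[of "(norm (T z - z))\<^sup>2" 0] by simp
  then show ?thesis
    by simp
qed

text \<open>Opial's principle. Every subfilter has an asymptotic centre, which is a fixed point, and the
  distances to fixed points have full limits; hence all subfilters have the same centre \<open>z\<close>. If
  \<open>\<langle>x\<^sub>k - z, v\<rangle> \<ge> \<epsilon>\<close> infinitely often, then along those indices \<open>z + v\<close> is closer to \<open>x\<^sub>k\<close> than the
  quadratic growth around \<open>z\<close> permits.\<close>

theorem weak_convergence_to_fixed_point:
  fixes T :: "'a::{real_inner, complete_space} \<Rightarrow> 'a" and x :: "nat \<Rightarrow> 'a"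
  assumes nonexpansive: "\<And>u v. norm (T u - T v) \<le> norm (u - v)"
    and approx: "(\<lambda>k. norm (x k - T (x k))) \<longlonglongrightarrow> 0"
    and fejer: "\<And>p. T p = p \<Longrightarrow> convergent (\<lambda>k. norm (x k - p))"
    and fixed: "T p0 = p0"
  obtains z where "T z = z" and "weakly_converges_to x z"
proof -
  obtain M where M: "\<And>k. norm (x k - p0) \<le> M"
    using BseqE[OF convergent_imp_Bseq[OF fejer[OF fixed]]]
    by (metis real_norm_def abs_norm_cancel)
  have bounded: "norm (x k - y) \<le> M + norm (p0 - y)" for k y
    using norm_triangle_ineq[of "x k - p0" "p0 - y"] M[of k] by simp
  have centre: "\<exists>z \<rho>. asymptotic_centre F x z \<rho> \<and> T z = z"
    if F: "F \<noteq> bot" "F \<le> sequentially" for F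
  proof -
    have "\<forall>\<^sub>F k in F. norm (x k) \<le> M + norm p0"
      using bounded[of _ 0] by simp
    then obtain z \<rho> where z: "asymptotic_centre F x z \<rho>"
      using asymptotic_centre_exists[OF F(1)] by blast
    have "T z = z"
      by (rule asymptotic_centre_fixed[OF z nonexpansive always_eventually[OF allI[OF bounded]]
            tendsto_mono[OF F(2) approx]])
    then show ?thesis
      using z by blast
  qed
  obtain z \<rho> where z: "asymptotic_centre sequentially x z \<rho>" and Tz: "T z = z"
    using centre[of sequentially] by auto
  obtain a where a: "(\<lambda>k. norm (x k - z)) \<longlonglongrightarrow> a"
    using fejer[OF Tz] convergent_def by blast
  \<comment> \<open>The centres \<open>z\<close> and \<open>w\<close> compete in both problems; adding the two growth inequalities
    leaves no room for a distance between them.\<close>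
  have subcentre: "asymptotic_centre F x z (a\<^sup>2)" if F: "F \<noteq> bot" "F \<le> sequentially" for F
  proof -
    obtain w \<rho>' where w: "asymptotic_centre F x w \<rho>'" and Tw: "T w = w"
      using centre[OF F] by blast
    obtain b where b: "(\<lambda>k. norm (x k - w)) \<longlonglongrightarrow> b"
      using fejer[OF Tw] convergent_def by blast
    have \<rho>': "\<rho>' = b\<^sup>2"
      by (rule asymptotic_centre_radius[OF F(1) w tendsto_mono[OF F(2) b]])
    have "b\<^sup>2 + (norm (z - w))\<^sup>2 \<le> a\<^sup>2"
      using asymptotic_centre_least[OF w tendsto_mono[OF F(2) a]] \<rho>' by simp
    moreover have "a\<^sup>2 + (norm (w - z))\<^sup>2 \<le> b\<^sup>2"
      using asymptotic_centre_least[OF z b] asymptotic_centre_radius[OF _ z a] by simp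
    ultimately have "(norm (z - w))\<^sup>2 + (norm (w - z))\<^sup>2 \<le> 0"
      by linarith
    then have "w = z"
      by (simp add: norm_minus_commute)
    then have "b = a"
      using LIMSEQ_unique[OF a] b by simp
    then show ?thesis
      using w \<rho>' \<open>w = z\<close> by simp
  qed
  have no_drift: "\<forall>\<^sub>F k in sequentially. inner (x k - z) v < \<epsilon>" if \<epsilon>: "0 < \<epsilon>" for v \<epsilon>
  proof (rule ccontr)
    assume frequent: "\<not> ?thesis"
    define F where "F = inf sequentially (principal {k. \<epsilon> \<le> inner (x k - z) v})"
    have F: "F \<noteq> bot" "F \<le> sequentially"
      using frequent unfolding F_def trivial_limit_def eventually_inf_principal
      by (auto simp: not_le)
    have "\<forall>\<^sub>F k in F. (norm (x k - z))\<^sup>2 \<le> a\<^sup>2 + \<epsilon>"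
      using subcentre[OF F] \<epsilon> unfolding asymptotic_centre_def by blast
    moreover have "\<forall>\<^sub>F k in F. \<epsilon> \<le> inner (x k - z) v"
      unfolding F_def eventually_inf_principal by simp
    ultimately have "\<forall>\<^sub>F k in F. (norm (x k - (z + v)))\<^sup>2 \<le> a\<^sup>2 - \<epsilon> + (norm v)\<^sup>2"
    proof eventually_elim
      case (elim k)
      have "(norm (x k - (z + v)))\<^sup>2 = (norm (x k - z))\<^sup>2 - 2 * inner (x k - z) v + (norm v)\<^sup>2"
        unfolding power2_norm_eq_inner
        by (simp add: inner_diff_left inner_diff_right inner_add_left inner_add_right inner_commute)
      then show ?case
        using elim by linarith
    qed
    then have "a\<^sup>2 + (norm ((z + v) - z))\<^sup>2 \<le> a\<^sup>2 - \<epsilon> + (norm v)\<^sup>2"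
      using subcentre[OF F] unfolding asymptotic_centre_def by blast
    then show False
      using \<epsilon> by simp
  qed
  have "(\<lambda>k. inner (x k) y) \<longlonglongrightarrow> inner z y" for y
  proof (rule tendstoI)
    fix \<epsilon> :: real assume "0 < \<epsilon>"
    from no_drift[OF this, of y] no_drift[OF this, of "- y"]
    show "\<forall>\<^sub>F k in sequentially. dist (inner (x k) y) (inner z y) < \<epsilon>"
      by eventually_elim (simp add: dist_real_def inner_diff_left abs_less_iff)
  qed
  then show thesis
    using that Tz unfolding weakly_converges_to_def by blast
qed

section \<open>Perturbed relaxed iterations\<close>

text \<open>Subtracting the partial sums of \<open>e\<close> from \<open>a\<close> leaves an eventually decreasing sequence that is
  bounded below and whose decrements dominate \<open>b\<close>.\<close>

lemma quasi_decreasing: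
  fixes a b e :: "nat \<Rightarrow> real"
  assumes step: "\<forall>\<^sub>F k in sequentially. a (Suc k) + b k \<le> a k + e k"
    and b: "\<forall>\<^sub>F k in sequentially. 0 \<le> b k"
    and a: "\<And>k. 0 \<le> a k" and e: "summable e"
  shows "convergent a" and "summable b"
proof -
  obtain N where N: "\<And>k. N \<le> k \<Longrightarrow> a (Suc k) + b k \<le> a k + e k" "\<And>k. N \<le> k \<Longrightarrow> 0 \<le> b k"
    using eventually_conj[OF step b] by (auto simp: eventually_sequentially)
  define S where "S = (\<lambda>k. \<Sum>i<k. e i)"
  have S: "convergent S"
    using e unfolding S_def summable_iff_convergent .
  obtain B where B: "\<And>k. \<bar>S k\<bar> \<le> B"
    using convergent_imp_Bseq[OF S] by (metis BseqE real_norm_def)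
  define s where "s = (\<lambda>k. a (k + N) - S (k + N))"
  have s: "s (Suc k) + b (k + N) \<le> s k" for k
    using N(1)[of "k + N"] by (simp add: s_def S_def)
  have low: "- B \<le> s k" for k
    using a[of "k + N"] B[of "k + N"] by (simp add: s_def)
  have "s (Suc k) \<le> s k" for k
    using s[of k] N(2)[of "k + N"] by simp
  then have "decseq s"
    by (rule decseq_SucI)
  then have "convergent s"
    using decseq_convergent[of s "- B"] low convergent_def by metis
  moreover have "convergent (\<lambda>k. S (k + N))"
    using S by (simp add: convergent_ignore_initial_segment)
  ultimately have "convergent (\<lambda>k. s k + S (k + N))"
    by (rule convergent_add)
  then show "convergent a"
    by (simp add: s_def convergent_ignore_initial_segment)
  have "(\<Sum>i<n. b (i + N)) \<le> s 0 - s n" for n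
  proof (induction n)
    case (Suc n)
    then show ?case
      using s[of n] by simp
  qed simp
  then have "(\<Sum>i<n. b (i + N)) \<le> s 0 + B" for n
    by (rule order_trans) (use low[of n] in simp)
  then have "summable (\<lambda>i. b (i + N))"
    using N(2) by (intro summableI_nonneg_bounded) auto
  then show "summable b"
    by (simp add: summable_iff_shift)
qed

text \<open>In terms of the reflection \<open>y - 2 d\<close> the step has coefficients \<open>\<beta> + \<gamma>/2\<close> and \<open>\<gamma>/2\<close>, which explains
  the form of the bound on the parameters.\<close>

lemma relaxed_step_norm_le:
  fixes y d :: "'a::real_inner"
  assumes co: "(norm d)\<^sup>2 \<le> inner y d" and par: "\<bar>\<beta> + \<gamma> / 2\<bar> + \<bar>\<gamma> / 2\<bar> \<le> 1"
  shows "norm (\<beta> *\<^sub>R y + \<gamma> *\<^sub>R (y - d)) \<le> norm y"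
proof -
  have "\<beta> *\<^sub>R y + \<gamma> *\<^sub>R (y - d) = (\<beta> + \<gamma> / 2) *\<^sub>R y + (\<gamma> / 2) *\<^sub>R (y - 2 *\<^sub>R d)"
    by (simp add: algebra_simps flip: scaleR_add_left)
  then have "norm (\<beta> *\<^sub>R y + \<gamma> *\<^sub>R (y - d))
      \<le> \<bar>\<beta> + \<gamma> / 2\<bar> * norm y + \<bar>\<gamma> / 2\<bar> * norm (y - 2 *\<^sub>R d)"
    using norm_triangle_ineq[of "(\<beta> + \<gamma> / 2) *\<^sub>R y" "(\<gamma> / 2) *\<^sub>R (y - 2 *\<^sub>R d)"] by simp
  also have "\<dots> \<le> \<bar>\<beta> + \<gamma> / 2\<bar> * norm y + \<bar>\<gamma> / 2\<bar> * norm y"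
    using reflection_norm_le[OF co] by (intro add_left_mono mult_left_mono) auto
  also have "\<dots> \<le> 1 * norm y"
    using mult_right_mono[OF par, of "norm y"] by (simp add: algebra_simps)
  finally show ?thesis
    by simp
qed

text \<open>The squared norm of the step \<open>(\<beta> + \<gamma>) y - \<gamma> d\<close> contains the cross term
  \<open>- 2 \<gamma> (\<beta> + \<gamma>) \<langle>y, d\<rangle>\<close>; the sign of its coefficient is what allows \<open>\<langle>y, d\<rangle>\<close> to be replaced by
  the smaller \<open>\<parallel>d\<parallel>\<^sup>2\<close>, and \<open>2 (\<beta> + \<gamma>) - \<gamma> = 2 \<beta> + \<gamma>\<close> remains.\<close>

lemma relaxed_step_decrease:
  fixes y d :: "'a::real_inner"
  assumes co: "(norm d)\<^sup>2 \<le> inner y d" and sum: "\<bar>\<beta> + \<gamma>\<bar> \<le> 1"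
    and sign: "0 \<le> \<gamma> * (\<beta> + \<gamma>)"
  shows "(norm (\<beta> *\<^sub>R y + \<gamma> *\<^sub>R (y - d)))\<^sup>2 \<le> (norm y)\<^sup>2 - \<gamma> * (2 * \<beta> + \<gamma>) * (norm d)\<^sup>2"
proof -
  have "\<beta> *\<^sub>R y + \<gamma> *\<^sub>R (y - d) = (\<beta> + \<gamma>) *\<^sub>R y - \<gamma> *\<^sub>R d"
    by (simp add: algebra_simps)
  then have "(norm (\<beta> *\<^sub>R y + \<gamma> *\<^sub>R (y - d)))\<^sup>2
      = (\<beta> + \<gamma>)\<^sup>2 * (norm y)\<^sup>2 - 2 * (\<gamma> * (\<beta> + \<gamma>) * inner y d) + \<gamma>\<^sup>2 * (norm d)\<^sup>2"
    unfolding power2_norm_eq_inner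
    by (simp add: inner_diff_left inner_diff_right inner_commute power2_eq_square algebra_simps)
  moreover have "\<gamma> * (\<beta> + \<gamma>) * (norm d)\<^sup>2 \<le> \<gamma> * (\<beta> + \<gamma>) * inner y d"
    using co sign by (rule mult_left_mono)
  moreover have "(\<beta> + \<gamma>)\<^sup>2 * (norm y)\<^sup>2 \<le> 1 * (norm y)\<^sup>2"
    using sum by (intro mult_right_mono) (auto simp: abs_square_le_1)
  ultimately show ?thesis
    by (simp add: algebra_simps power2_eq_square)
qed

text \<open>Here \<open>d\<close> and \<open>d'\<close> are the residuals of one firmly nonexpansive map at \<open>x\<close> and \<open>x'\<close>. Nonexpansiveness
  of its reflection bounds \<open>2 d'\<close> by a part of size \<open>\<gamma> \<parallel>d\<parallel>\<close>, from moving \<open>x\<close> to \<open>x'\<close>, and a part of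
  size \<open>(2 - \<gamma>) \<parallel>d\<parallel>\<close>, which together make \<open>2 \<parallel>d\<parallel>\<close>, up to the error \<open>e\<close>, as long as \<open>\<gamma>\<close> lies in \<open>[0, 2]\<close>.\<close>

lemma relaxed_step_residual:
  fixes x x' d d' e :: "'a::real_inner"
  assumes firm: "(norm (d - d'))\<^sup>2 \<le> inner (x - x') (d - d')"
    and x': "x' = x - \<gamma> *\<^sub>R d + e" and \<gamma>: "0 \<le> \<gamma>" "\<gamma> \<le> 2"
  shows "norm d' \<le> norm d + norm e"
proof -
  have "2 *\<^sub>R d' = ((x - x') - 2 *\<^sub>R (d - d')) + ((2 - \<gamma>) *\<^sub>R d + e)"
    unfolding x' by (simp add: algebra_simps)
  from arg_cong[OF this, of norm] have "norm (2 *\<^sub>R d')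
      \<le> norm ((x - x') - 2 *\<^sub>R (d - d')) + (norm ((2 - \<gamma>) *\<^sub>R d) + norm e)"
    using norm_triangle_ineq[of "(x - x') - 2 *\<^sub>R (d - d')" "(2 - \<gamma>) *\<^sub>R d + e"]
      norm_triangle_ineq[of "(2 - \<gamma>) *\<^sub>R d" e] by linarith
  also have "\<dots> \<le> norm (\<gamma> *\<^sub>R d - e) + (norm ((2 - \<gamma>) *\<^sub>R d) + norm e)"
    using reflection_norm_le[OF firm] x' by simp
  also have "\<dots> \<le> (\<gamma> * norm d + norm e) + ((2 - \<gamma>) * norm d + norm e)"
    using norm_triangle_ineq4[of "\<gamma> *\<^sub>R d" e] \<gamma> by simp
  finally show ?thesis
    by (simp add: algebra_simps)
qed

lemma summable_imp_bounded:
  fixes f :: "nat \<Rightarrow> real"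
  assumes "summable f"
  obtains B where "\<And>k. \<bar>f k\<bar> \<le> B"
  using convergent_imp_Bseq[of f] summable_LIMSEQ_zero[OF assms]
  by (metis BseqE convergentI real_norm_def)

lemma relaxed_parameter_sum_le:
  fixes \<beta> \<gamma> :: real
  assumes "\<bar>\<beta> + \<gamma> / 2\<bar> + \<bar>\<gamma> / 2\<bar> \<le> 1"
  shows "\<bar>\<beta> + \<gamma>\<bar> \<le> 1"
  using abs_triangle_ineq[of "\<beta> + \<gamma> / 2" "\<gamma> / 2"] assms by simp

text \<open>Seen from \<open>z\<close>, the step is an unperturbed relaxed step plus \<open>s\<^sub>k - (1 - \<beta>\<^sub>k - \<gamma>\<^sub>k) z\<close>, a summable
  error. The first conclusion adds up norms; the second adds up squared norms, for which the errors
  remain summable because the iterates are bounded by the first.\<close>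

lemma perturbed_iteration:
  fixes x d s :: "nat \<Rightarrow> 'a::real_inner" and \<beta> \<gamma> :: "nat \<Rightarrow> real" and z :: 'a
  assumes step: "\<And>k. x (Suc k) = \<beta> k *\<^sub>R x k + \<gamma> k *\<^sub>R (x k - d k) + s k"
    and co: "\<And>k. (norm (d k))\<^sup>2 \<le> inner (x k - z) (d k)"
    and par: "\<And>k. \<bar>\<beta> k + \<gamma> k / 2\<bar> + \<bar>\<gamma> k / 2\<bar> \<le> 1"
    and defect: "summable (\<lambda>k. \<bar>1 - \<beta> k - \<gamma> k\<bar>)" and s: "summable (\<lambda>k. norm (s k))"
  shows "convergent (\<lambda>k. norm (x k - z))"
    and "\<lbrakk>\<forall>\<^sub>F k in sequentially. 0 \<le> \<gamma> k * (\<beta> k + \<gamma> k);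
          \<forall>\<^sub>F k in sequentially. 0 \<le> \<gamma> k * (2 * \<beta> k + \<gamma> k)\<rbrakk>
         \<Longrightarrow> summable (\<lambda>k. \<gamma> k * (2 * \<beta> k + \<gamma> k) * (norm (d k))\<^sup>2)"
proof -
  define y where "y = (\<lambda>k. x k - z)"
  define P where "P = (\<lambda>k. \<beta> k *\<^sub>R y k + \<gamma> k *\<^sub>R (y k - d k))"
  define \<eta> where "\<eta> = (\<lambda>k. norm (s k) + \<bar>1 - \<beta> k - \<gamma> k\<bar> * norm z)"
  have \<eta>: "summable \<eta>"
    unfolding \<eta>_def by (intro summable_add s summable_mult2 defect)
  have \<eta>_nonneg: "0 \<le> \<eta> k" for k
    by (simp add: \<eta>_def)
  have co': "(norm (d k))\<^sup>2 \<le> inner (y k) (d k)" for k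
    using co by (simp add: y_def)
  have P_le: "norm (P k) \<le> norm (y k)" for k
    unfolding P_def by (rule relaxed_step_norm_le[OF co' par])
  have y_Suc: "norm (y (Suc k)) \<le> norm (P k) + \<eta> k" for k
  proof -
    have "y (Suc k) = P k + (s k - (1 - \<beta> k - \<gamma> k) *\<^sub>R z)"
      unfolding y_def P_def step by (simp add: algebra_simps)
    then have "norm (y (Suc k)) \<le> norm (P k) + norm (s k - (1 - \<beta> k - \<gamma> k) *\<^sub>R z)"
      using norm_triangle_ineq by metis
    also have "norm (s k - (1 - \<beta> k - \<gamma> k) *\<^sub>R z) \<le> \<eta> k"
      unfolding \<eta>_def by (metis norm_scaleR norm_triangle_ineq4)
    finally show ?thesis
      by simp
  qed
  have y_step: "norm (y (Suc k)) \<le> norm (y k) + \<eta> k" for k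
    using y_Suc[of k] P_le[of k] by simp
  have "convergent (\<lambda>k. norm (y k))"
    using quasi_decreasing(1)[of "\<lambda>k. norm (y k)" "\<lambda>_. 0" \<eta>] y_step \<eta> by simp
  then show "convergent (\<lambda>k. norm (x k - z))"
    by (simp add: y_def)
  obtain M where M: "\<And>k. norm (y k) \<le> M"
    using BseqE[OF convergent_imp_Bseq[OF \<open>convergent (\<lambda>k. norm (y k))\<close>]]
    by (metis real_norm_def abs_norm_cancel)
  obtain E where E: "\<And>k. \<bar>\<eta> k\<bar> \<le> E"
    using summable_imp_bounded[OF \<eta>] by blast
  assume sign: "\<forall>\<^sub>F k in sequentially. 0 \<le> \<gamma> k * (\<beta> k + \<gamma> k)"
    and weight: "\<forall>\<^sub>F k in sequentially. 0 \<le> \<gamma> k * (2 * \<beta> k + \<gamma> k)"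
  have "\<forall>\<^sub>F k in sequentially. (norm (y (Suc k)))\<^sup>2 + \<gamma> k * (2 * \<beta> k + \<gamma> k) * (norm (d k))\<^sup>2
      \<le> (norm (y k))\<^sup>2 + (2 * M + E) * \<eta> k"
    using sign
  proof eventually_elim
    case (elim k)
    have "(norm (y (Suc k)))\<^sup>2 \<le> (norm (P k) + \<eta> k)\<^sup>2"
      using y_Suc by (intro power_mono) auto
    also have "\<dots> = (norm (P k))\<^sup>2 + (2 * norm (P k) + \<eta> k) * \<eta> k"
      by (simp add: power2_eq_square algebra_simps)
    also have "\<dots> \<le> (norm (P k))\<^sup>2 + (2 * M + E) * \<eta> k"
      using P_le[of k] M[of k] E[of k] \<eta>_nonneg[of k] by (intro add_left_mono mult_right_mono) auto
    also have "(norm (P k))\<^sup>2 \<le> (norm (y k))\<^sup>2 - \<gamma> k * (2 * \<beta> k + \<gamma> k) * (norm (d k))\<^sup>2"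
      unfolding P_def by (rule relaxed_step_decrease[OF co' relaxed_parameter_sum_le[OF par] elim])
    finally show ?case
      by simp
  qed
  then show "summable (\<lambda>k. \<gamma> k * (2 * \<beta> k + \<gamma> k) * (norm (d k))\<^sup>2)"
  proof (rule quasi_decreasing(2))
    show "\<forall>\<^sub>F k in sequentially. 0 \<le> \<gamma> k * (2 * \<beta> k + \<gamma> k) * (norm (d k))\<^sup>2"
      using weight by eventually_elim simp
  qed (auto intro: summable_mult \<eta>)
qed

lemma limit_zero_of_bounded_weights:
  fixes b r :: "nat \<Rightarrow> real"
  assumes weighted: "summable (\<lambda>k. b k * (r k)\<^sup>2)"
    and m: "0 < m" "\<forall>\<^sub>F k in sequentially. m \<le> b k"
  shows "r \<longlonglongrightarrow> 0"
proof -
  have "(\<lambda>k. b k * (r k)\<^sup>2 / m) \<longlonglongrightarrow> 0 / m"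
    using m(1) by (intro tendsto_divide summable_LIMSEQ_zero[OF weighted]) auto
  moreover have "\<forall>\<^sub>F k in sequentially. norm ((r k)\<^sup>2) \<le> b k * (r k)\<^sup>2 / m"
    using m(2)
  proof eventually_elim
    case (elim k)
    then have "m * (r k)\<^sup>2 \<le> b k * (r k)\<^sup>2"
      by (intro mult_right_mono) auto
    then show ?case
      using m(1) by (simp add: field_simps)
  qed
  ultimately have "(\<lambda>k. (r k)\<^sup>2) \<longlonglongrightarrow> 0"
    by (intro Lim_null_comparison[of "\<lambda>k. (r k)\<^sup>2"]) auto
  from tendsto_real_sqrt[OF this] show ?thesis
    by (simp add: tendsto_rabs_zero_iff)
qed

text \<open>A nonzero limit of \<open>r\<close> would make \<open>b\<close> itself summable by comparison.\<close>

lemma limit_zero_of_divergent_weights: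
  fixes b r :: "nat \<Rightarrow> real"
  assumes weighted: "summable (\<lambda>k. b k * (r k)\<^sup>2)"
    and b: "\<And>k. 0 \<le> b k" and diverges: "filterlim (\<lambda>n. \<Sum>k<n. b k) at_top sequentially"
    and r: "convergent r"
  shows "r \<longlonglongrightarrow> 0"
proof -
  obtain l where l: "r \<longlonglongrightarrow> l"
    using r convergent_def by blast
  have "l = 0"
  proof (rule ccontr)
    assume "l \<noteq> 0"
    then have "\<forall>\<^sub>F k in sequentially. l\<^sup>2 / 2 < (r k)\<^sup>2"
      by (intro order_tendstoD(1)[OF tendsto_power[OF l]]) simp
    then have "\<forall>\<^sub>F k in sequentially. norm (b k * (l\<^sup>2 / 2)) \<le> b k * (r k)\<^sup>2"
    proof eventually_elim
      case (elim k)
      then have "b k * (l\<^sup>2 / 2) \<le> b k * (r k)\<^sup>2"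
        using b by (intro mult_left_mono) auto
      then show ?case
        using b[of k] by simp
    qed
    then have "summable (\<lambda>k. b k * (l\<^sup>2 / 2))"
      by (rule summable_comparison_test_ev[OF _ weighted])
    from summable_mult2[OF this, of "2 / l\<^sup>2"] have "summable b"
      using \<open>l \<noteq> 0\<close> by simp
    then have "convergent (\<lambda>n. \<Sum>k<n. b k)"
      by (simp add: summable_iff_convergent)
    then obtain L where "(\<lambda>n. \<Sum>k<n. b k) \<longlonglongrightarrow> L"
      using convergent_def by blast
    then show False
      using not_tendsto_and_filterlim_at_infinity[OF _ _ filterlim_at_top_imp_at_infinity[OF diverges]]
      by simp
  qed
  then show ?thesis
    using l by simp
qed

section \<open>The generalised proximal point iteration\<close>

text \<open>The residual of the \<open>k\<close>-th resolvent grows by at most a summable amount from \<open>x\<^sub>k\<close> to \<open>x\<^sub>k\<^sub>+\<^sub>1\<close>, as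
  the step is a relaxation with factor \<open>\<gamma>\<^sub>k\<close> in \<open>[0, 2]\<close> up to a summable error. Replacing the
  parameter \<open>c\<^sub>k\<close> by \<open>c\<^sub>k\<^sub>+\<^sub>1\<close> multiplies it by at most \<open>1 + \<bar>c\<^sub>k\<^sub>+\<^sub>1 - c\<^sub>k\<bar> / m\<close>, again a summable change
  since residuals are bounded.\<close>

lemma resolvent_residual_convergent:
  fixes A :: "'a::{real_inner, complete_space} \<Rightarrow> 'a set" and x s :: "nat \<Rightarrow> 'a"
    and c \<beta> \<gamma> :: "nat \<Rightarrow> real"
  defines "d \<equiv> \<lambda>k. x k - resolvent (c k) A (x k)"
  assumes max: "maximally_monotone A" and c: "\<And>k. 0 < c k"
    and step: "\<And>k. x (Suc k) = \<beta> k *\<^sub>R x k + \<gamma> k *\<^sub>R (x k - d k) + s k"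
    and \<gamma>: "\<forall>\<^sub>F k in sequentially. 0 \<le> \<gamma> k \<and> \<gamma> k \<le> 2"
    and defect: "summable (\<lambda>k. \<bar>1 - \<beta> k - \<gamma> k\<bar>)" and s: "summable (\<lambda>k. norm (s k))"
    and x_bound: "\<And>k. norm (x k) \<le> X" and d_bound: "\<And>k. norm (d k) \<le> D"
    and m: "0 < m" "\<forall>\<^sub>F k in sequentially. m \<le> c k"
    and c_var: "summable (\<lambda>k. \<bar>c (Suc k) - c k\<bar>)"
  shows "convergent (\<lambda>k. norm (d k))"
proof -
  define \<epsilon> where "\<epsilon> = (\<lambda>k. s k - (1 - \<beta> k - \<gamma> k) *\<^sub>R x k)"
  define \<eta> where "\<eta> = (\<lambda>k. norm (s k) + \<bar>1 - \<beta> k - \<gamma> k\<bar> * X)"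
  define \<theta> where "\<theta> = (\<lambda>k. \<bar>c (Suc k) - c k\<bar> / m)"
  have \<eta>: "summable \<eta>"
    unfolding \<eta>_def by (intro summable_add s summable_mult2 defect)
  have \<theta>: "summable \<theta>"
    unfolding \<theta>_def by (intro summable_divide c_var)
  have \<epsilon>_le: "norm (\<epsilon> k) \<le> \<eta> k" for k
  proof -
    have "norm (\<epsilon> k) \<le> norm (s k) + \<bar>1 - \<beta> k - \<gamma> k\<bar> * norm (x k)"
      unfolding \<epsilon>_def by (metis norm_scaleR norm_triangle_ineq4)
    also have "\<dots> \<le> \<eta> k"
      unfolding \<eta>_def using x_bound by (intro add_left_mono mult_left_mono) auto
    finally show ?thesis .
  qed
  obtain E where E: "\<And>k. \<bar>\<eta> k\<bar> \<le> E"
    using summable_imp_bounded[OF \<eta>] by blast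
  have "\<forall>\<^sub>F k in sequentially. norm (d (Suc k)) + 0 \<le> norm (d k) + (\<eta> k + \<theta> k * (D + E))"
    using \<gamma> m(2)
  proof eventually_elim
    case (elim k)
    let ?d' = "x (Suc k) - resolvent (c k) A (x (Suc k))"
    have "x (Suc k) = x k - \<gamma> k *\<^sub>R d k + \<epsilon> k"
      unfolding step \<epsilon>_def by (simp add: algebra_simps)
    moreover have "(norm (d k - ?d'))\<^sup>2 \<le> inner (x k - x (Suc k)) (d k - ?d')"
      unfolding d_def by (rule resolvent_firmly_nonexpansive[OF max c])
    ultimately have d': "norm ?d' \<le> norm (d k) + norm (\<epsilon> k)"
      using relaxed_step_residual elim(1) by blast
    have ratio: "\<bar>1 - c (Suc k) / c k\<bar> \<le> \<theta> k"
    proof -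
      have "1 - c (Suc k) / c k = (c k - c (Suc k)) / c k"
        using c[of k] by (simp add: field_simps)
      then have "\<bar>1 - c (Suc k) / c k\<bar> = \<bar>c (Suc k) - c k\<bar> / c k"
        using c[of k] by (simp add: abs_divide abs_minus_commute)
      also have "\<dots> \<le> \<theta> k"
        unfolding \<theta>_def using elim(2) m(1) by (intro divide_left_mono) auto
      finally show ?thesis .
    qed
    have "norm (d (Suc k)) \<le> (1 + \<bar>1 - c (Suc k) / c k\<bar>) * norm ?d'"
      unfolding d_def by (rule resolvent_parameter_change[OF max c c])
    also have "\<dots> \<le> (1 + \<theta> k) * norm ?d'"
      using ratio by (intro mult_right_mono) auto
    also have "\<dots> = norm ?d' + \<theta> k * norm ?d'"
      by (simp add: algebra_simps)
    also have "\<dots> \<le> (norm (d k) + \<eta> k) + \<theta> k * (D + E)"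
      using d' \<epsilon>_le[of k] d_bound[of k] E[of k] m(1)
      by (intro add_mono mult_left_mono) (auto simp: \<theta>_def)
    finally show ?case
      by simp
  qed
  then show ?thesis
    by (rule quasi_decreasing(1)) (simp_all add: summable_add[OF \<eta> summable_mult2[OF \<theta>]])
qed

text \<open>Residuals for \<open>c\<^sub>k \<ge> m\<close> dominate, up to the factor 2, the residuals of the resolvent with parameter
  \<open>m\<close>, to which Opial's principle applies.\<close>

lemma resolvent_iteration_weak_limit:
  fixes A :: "'a::{real_inner, complete_space} \<Rightarrow> 'a set" and x :: "nat \<Rightarrow> 'a"
  assumes max: "maximally_monotone A" and zer: "zer A \<noteq> {}" and c: "\<And>k. 0 < c k"
    and m: "0 < m" "\<forall>\<^sub>F k in sequentially. m \<le> c k"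
    and fejer: "\<And>z. z \<in> zer A \<Longrightarrow> convergent (\<lambda>k. norm (x k - z))"
    and residual: "(\<lambda>k. norm (x k - resolvent (c k) A (x k))) \<longlonglongrightarrow> 0"
  shows "\<exists>z\<in>zer A. weakly_converges_to x z"
proof -
  let ?T = "resolvent m A"
  have "\<forall>\<^sub>F k in sequentially. norm (norm (x k - ?T (x k)))
      \<le> 2 * norm (x k - resolvent (c k) A (x k))"
    using m(2)
  proof eventually_elim
    case (elim k)
    have "\<bar>1 - m / c k\<bar> \<le> 1"
      using elim m(1) c[of k] by (simp add: abs_le_iff)
    then have "(1 + \<bar>1 - m / c k\<bar>) * norm (x k - resolvent (c k) A (x k))
        \<le> 2 * norm (x k - resolvent (c k) A (x k))"
      by (intro mult_right_mono) auto
    then show ?case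
      using resolvent_parameter_change[OF max c[of k] m(1), of "x k"] by simp
  qed
  moreover have "(\<lambda>k. 2 * norm (x k - resolvent (c k) A (x k))) \<longlonglongrightarrow> 2 * 0"
    by (intro tendsto_intros residual)
  ultimately have approx: "(\<lambda>k. norm (x k - ?T (x k))) \<longlonglongrightarrow> 0"
    using Lim_null_comparison by fastforce
  obtain p where p: "p \<in> zer A"
    using zer by blast
  obtain z where "?T z = z" "weakly_converges_to x z"
    using weak_convergence_to_fixed_point[of ?T x p, OF resolvent_nonexpansive[OF max m(1)] approx]
      fejer p resolvent_fixed_iff[OF max m(1)] by blast
  then show ?thesis
    using resolvent_fixed_iff[OF max m(1)] by blast
qed

lemma weights_positive_if_relaxation_tends_to_one:
  fixes \<beta> \<gamma> :: "nat \<Rightarrow> real"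
  assumes sum: "(\<lambda>k. \<beta> k + \<gamma> k) \<longlonglongrightarrow> 1" and \<gamma>: "\<gamma> \<longlonglongrightarrow> 1"
  shows "\<forall>\<^sub>F k in sequentially. 0 \<le> \<gamma> k * (\<beta> k + \<gamma> k)"
    and "\<forall>\<^sub>F k in sequentially. 1 / 2 \<le> \<gamma> k * (2 * \<beta> k + \<gamma> k)"
proof -
  have "(\<lambda>k. \<gamma> k * (\<beta> k + \<gamma> k)) \<longlonglongrightarrow> 1 * 1"
    by (intro tendsto_intros sum \<gamma>)
  then have "\<forall>\<^sub>F k in sequentially. 0 < \<gamma> k * (\<beta> k + \<gamma> k)"
    by (rule order_tendstoD) simp
  then show "\<forall>\<^sub>F k in sequentially. 0 \<le> \<gamma> k * (\<beta> k + \<gamma> k)"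
    by eventually_elim simp
  have "(\<lambda>k. \<gamma> k * (2 * (\<beta> k + \<gamma> k) - \<gamma> k)) \<longlonglongrightarrow> 1 * (2 * 1 - 1)"
    by (intro tendsto_intros sum \<gamma>)
  then have "\<forall>\<^sub>F k in sequentially. 1 / 2 < \<gamma> k * (2 * (\<beta> k + \<gamma> k) - \<gamma> k)"
    by (rule order_tendstoD) simp
  then show "\<forall>\<^sub>F k in sequentially. 1 / 2 \<le> \<gamma> k * (2 * \<beta> k + \<gamma> k)"
    by eventually_elim (simp add: algebra_simps)
qed

text \<open>With \<open>f\<^sub>k = 1 - \<beta>\<^sub>k - \<gamma>\<^sub>k/2\<close>, the second factor of the weight is \<open>2 (1 - f\<^sub>k)\<close>, and
  \<open>\<gamma>\<^sub>k = 2 f\<^sub>k - 2 (1 - \<beta>\<^sub>k - \<gamma>\<^sub>k)\<close> differs from \<open>2 f\<^sub>k\<close> by a null sequence, so that it eventually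
  exceeds \<open>l\<close>.\<close>

lemma weights_positive_if_relaxation_bounded_away:
  fixes \<beta> \<gamma> :: "nat \<Rightarrow> real"
  assumes sum: "(\<lambda>k. \<beta> k + \<gamma> k) \<longlonglongrightarrow> 1" and lh: "0 < l" "h < 1"
    and low: "\<forall>\<^sub>F k in sequentially. l < 1 - \<beta> k - \<gamma> k / 2"
    and high: "\<forall>\<^sub>F k in sequentially. 1 - \<beta> k - \<gamma> k / 2 < h"
  shows "\<forall>\<^sub>F k in sequentially. 0 \<le> \<gamma> k * (\<beta> k + \<gamma> k)"
    and "\<forall>\<^sub>F k in sequentially. l * (2 * (1 - h)) \<le> \<gamma> k * (2 * \<beta> k + \<gamma> k)"
proof -
  have "\<forall>\<^sub>F k in sequentially. max 0 (1 - l / 2) < \<beta> k + \<gamma> k"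
    using lh(1) by (intro order_tendstoD(1)[OF sum]) simp
  then have "\<forall>\<^sub>F k in sequentially. l \<le> \<gamma> k \<and> 0 \<le> \<beta> k + \<gamma> k \<and> 2 * (1 - h) \<le> 2 * \<beta> k + \<gamma> k"
    using low high by eventually_elim auto
  then have *: "\<forall>\<^sub>F k in sequentially. 0 \<le> \<gamma> k * (\<beta> k + \<gamma> k) \<and>
      l * (2 * (1 - h)) \<le> \<gamma> k * (2 * \<beta> k + \<gamma> k)"
  proof eventually_elim
    case (elim k)
    then have "l * (2 * (1 - h)) \<le> \<gamma> k * (2 * \<beta> k + \<gamma> k)"
      using lh by (intro mult_mono) auto
    then show ?case
      using elim lh(1) by simp
  qed
  show "\<forall>\<^sub>F k in sequentially. 0 \<le> \<gamma> k * (\<beta> k + \<gamma> k)"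
    using * by eventually_elim simp
  show "\<forall>\<^sub>F k in sequentially. l * (2 * (1 - h)) \<le> \<gamma> k * (2 * \<beta> k + \<gamma> k)"
    using * by eventually_elim simp
qed

text \<open>Gathering \<open>\<alpha>\<^sub>k u + \<delta>\<^sub>k e\<^sub>k\<close> into one summable perturbation puts the recursion into the form treated
  above. The first three alternatives are reduced to weights bounded below by a positive constant;
  in the fourth, \<open>\<beta>\<^sub>k + \<gamma>\<^sub>k \<longlonglongrightarrow> 1\<close> and \<open>\<gamma>\<^sub>k (\<beta>\<^sub>k + \<gamma>\<^sub>k) \<ge> 0\<close> make \<open>\<gamma>\<^sub>k\<close> eventually nonnegative,
  and the bound on the parameters gives \<open>\<gamma>\<^sub>k \<le> 2\<close>.\<close>

theorem theorem4p1:
  fixes A :: "'a::{real_inner, complete_space} \<Rightarrow> 'a set"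
    and u :: 'a
    and x e :: "nat \<Rightarrow> 'a"
    and c \<alpha> \<beta> \<gamma> \<delta> :: "nat \<Rightarrow> real"
  assumes nontrivial: "(UNIV :: 'a set) \<noteq> {0}"
    and "maximally_monotone A"
    and "zer A \<noteq> {}"
    and "\<And>k. c k > 0"
    and "\<And>k. x (Suc k) =
           \<alpha> k *\<^sub>R u + \<beta> k *\<^sub>R x k + \<gamma> k *\<^sub>R resolvent (c k) A (x k) + \<delta> k *\<^sub>R e k"
    and "\<And>k. \<bar>\<beta> k + \<gamma> k / 2\<bar> + \<bar>\<gamma> k / 2\<bar> \<le> 1"
    and "summable (\<lambda>k. \<bar>\<alpha> k\<bar>)"
    and "summable (\<lambda>k. \<bar>1 - \<beta> k - \<gamma> k\<bar>)"
    and "summable (\<lambda>k. norm (\<delta> k *\<^sub>R e k))"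
    and "(\<gamma> \<longlonglongrightarrow> 1 \<and>
           ((INF k. ereal (c k)) > 0 \<or> filterlim c at_top sequentially))
       \<or> (limsup (\<lambda>k. ereal \<bar>\<beta> k\<bar>) < 1 \<and>
           0 < liminf (\<lambda>k. ereal (1 - \<beta> k - \<gamma> k / 2)) \<and>
           liminf (\<lambda>k. ereal (1 - \<beta> k - \<gamma> k / 2)) \<le> limsup (\<lambda>k. ereal (1 - \<beta> k - \<gamma> k / 2)) \<and>
           limsup (\<lambda>k. ereal (1 - \<beta> k - \<gamma> k / 2)) < 1 \<and>
           (\<lambda>k. 1 - c k / c (Suc k)) \<longlonglongrightarrow> 0 \<and>
           ((INF k. ereal (c k)) > 0 \<or> filterlim c at_top sequentially))
       \<or> ((INF k. ereal (\<gamma> k * (\<beta> k + \<gamma> k))) \<ge> 0 \<and>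
           liminf (\<lambda>k. ereal (\<gamma> k * (2 * \<beta> k + \<gamma> k))) > 0 \<and>
           ((INF k. ereal (c k)) > 0 \<or> filterlim c at_top sequentially))
       \<or> ((INF k. ereal (\<gamma> k * (\<beta> k + \<gamma> k))) \<ge> 0 \<and>
           (INF k. ereal (\<gamma> k * (2 * \<beta> k + \<gamma> k))) \<ge> 0 \<and>
           filterlim (\<lambda>n. \<Sum>k<n. \<gamma> k * (2 * \<beta> k + \<gamma> k)) at_top sequentially \<and>
           (\<forall>k. \<bar>\<beta> k + \<gamma> k\<bar> * \<bar>\<gamma> k\<bar> \<le> max (1 - \<bar>\<beta> k\<bar>) (2 - 2 * \<bar>\<beta> k + \<gamma> k / 2\<bar>)) \<and>
           (INF k. ereal (c k)) > 0 \<and>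
           summable (\<lambda>k. \<bar>c (Suc k) - c k\<bar>))"
  shows "\<exists>z \<in> zer A. weakly_converges_to x z"
proof -
  note max = assms(2) and zer = assms(3) and c = assms(4) and step = assms(5)
    and par = assms(6) and defect = assms(8)
  define d where "d = (\<lambda>k. x k - resolvent (c k) A (x k))"
  define s where "s = (\<lambda>k. \<alpha> k *\<^sub>R u + \<delta> k *\<^sub>R e k)"
  have step': "x (Suc k) = \<beta> k *\<^sub>R x k + \<gamma> k *\<^sub>R (x k - d k) + s k" for k
    unfolding step d_def s_def by simp
  have s_le: "norm (s k) \<le> \<bar>\<alpha> k\<bar> * norm u + norm (\<delta> k *\<^sub>R e k)" for k
    unfolding s_def using norm_triangle_ineq[of "\<alpha> k *\<^sub>R u" "\<delta> k *\<^sub>R e k"] by simp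
  have s: "summable (\<lambda>k. norm (s k))"
  proof (rule summable_comparison_test)
    show "summable (\<lambda>k. \<bar>\<alpha> k\<bar> * norm u + norm (\<delta> k *\<^sub>R e k))"
      by (intro summable_add summable_mult2 assms(7,9))
    show "\<exists>N. \<forall>k\<ge>N. norm (norm (s k)) \<le> \<bar>\<alpha> k\<bar> * norm u + norm (\<delta> k *\<^sub>R e k)"
      using s_le by simp
  qed
  have co: "(norm (d k))\<^sup>2 \<le> inner (x k - z) (d k)" if "z \<in> zer A" for z k
    unfolding d_def by (rule resolvent_step_cocoercive[OF max c that])
  have fejer: "convergent (\<lambda>k. norm (x k - z))" if "z \<in> zer A" for z
    by (rule perturbed_iteration(1)[OF step' co[OF that] par defect s])
  obtain z where z: "z \<in> zer A"
    using zer by blast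
  note weighted = perturbed_iteration(2)[OF step' co[OF z] par defect s]
  have sum_lim: "(\<lambda>k. \<beta> k + \<gamma> k) \<longlonglongrightarrow> 1"
  proof -
    have "(\<lambda>k. 1 - \<beta> k - \<gamma> k) \<longlonglongrightarrow> 0"
      using summable_LIMSEQ_zero[OF defect] by (simp add: tendsto_rabs_zero_iff)
    from tendsto_diff[OF tendsto_const[of 1] this] show ?thesis
      by simp
  qed
  have c_low: "\<exists>m>0. \<forall>\<^sub>F k in sequentially. m \<le> c k"
    if "(INF k. ereal (c k)) > 0 \<or> filterlim c at_top sequentially"
    using that
  proof
    assume "(INF k. ereal (c k)) > 0"
    then obtain m where m: "ereal 0 < ereal m" "ereal m < (INF k. ereal (c k))"
      using ereal_dense2[of 0 "INF k. ereal (c k)"] by (auto simp: zero_ereal_def)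
    have "m \<le> c k" for k
      using less_INF_D[OF m(2), of k] by simp
    then show ?thesis
      using m(1) by auto
  next
    assume "filterlim c at_top sequentially"
    then have "\<forall>\<^sub>F k in sequentially. 1 \<le> c k"
      by (simp add: filterlim_at_top)
    then show ?thesis
      by (intro exI[of _ 1]) simp
  qed
  have bounded_weights: "\<exists>z\<in>zer A. weakly_converges_to x z"
    if sign: "\<forall>\<^sub>F k in sequentially. 0 \<le> \<gamma> k * (\<beta> k + \<gamma> k)"
      and w: "0 < w" "\<forall>\<^sub>F k in sequentially. w \<le> \<gamma> k * (2 * \<beta> k + \<gamma> k)"
      and c_alt: "(INF k. ereal (c k)) > 0 \<or> filterlim c at_top sequentially" for w
  proof -
    have "\<forall>\<^sub>F k in sequentially. 0 \<le> \<gamma> k * (2 * \<beta> k + \<gamma> k)"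
      using w(2) by eventually_elim (use w(1) in simp)
    from limit_zero_of_bounded_weights[OF weighted[OF sign this] w]
    have residual: "(\<lambda>k. norm (x k - resolvent (c k) A (x k))) \<longlonglongrightarrow> 0"
      by (simp add: d_def)
    obtain m where m: "0 < m" "\<forall>\<^sub>F k in sequentially. m \<le> c k"
      using c_low[OF c_alt] by blast
    show ?thesis
      by (rule resolvent_iteration_weak_limit[OF max zer c m fejer residual])
  qed
  have nonneg: "0 \<le> f k" if "(INF k. ereal (f k)) \<ge> 0" for f :: "nat \<Rightarrow> real" and k
    using order_trans[OF that INF_lower[of k UNIV "\<lambda>k. ereal (f k)"]] by simp
  consider
    (to_one) "\<gamma> \<longlonglongrightarrow> 1" "(INF k. ereal (c k)) > 0 \<or> filterlim c at_top sequentially"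
  | (bounded_away) "0 < liminf (\<lambda>k. ereal (1 - \<beta> k - \<gamma> k / 2))"
      "limsup (\<lambda>k. ereal (1 - \<beta> k - \<gamma> k / 2)) < 1"
      "(INF k. ereal (c k)) > 0 \<or> filterlim c at_top sequentially"
  | (positive_weights) "(INF k. ereal (\<gamma> k * (\<beta> k + \<gamma> k))) \<ge> 0"
      "liminf (\<lambda>k. ereal (\<gamma> k * (2 * \<beta> k + \<gamma> k))) > 0"
      "(INF k. ereal (c k)) > 0 \<or> filterlim c at_top sequentially"
  | (divergent_weights) "(INF k. ereal (\<gamma> k * (\<beta> k + \<gamma> k))) \<ge> 0"
      "(INF k. ereal (\<gamma> k * (2 * \<beta> k + \<gamma> k))) \<ge> 0"
      "filterlim (\<lambda>n. \<Sum>k<n. \<gamma> k * (2 * \<beta> k + \<gamma> k)) at_top sequentially"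
      "(INF k. ereal (c k)) > 0" "summable (\<lambda>k. \<bar>c (Suc k) - c k\<bar>)"
    using assms(10) by argo
  then show ?thesis
  proof cases
    case to_one
    note \<gamma> = to_one(1) and c_alt = to_one(2)
    show ?thesis
      using bounded_weights[OF weights_positive_if_relaxation_tends_to_one(1)[OF sum_lim \<gamma>] _
          weights_positive_if_relaxation_tends_to_one(2)[OF sum_lim \<gamma>] c_alt] by simp
  next
    case bounded_away
    note low = bounded_away(1) and high = bounded_away(2) and c_alt = bounded_away(3)
    obtain l where l: "0 < ereal l" "ereal l < liminf (\<lambda>k. ereal (1 - \<beta> k - \<gamma> k / 2))"
      using ereal_dense2[OF low] by auto
    obtain h where h: "limsup (\<lambda>k. ereal (1 - \<beta> k - \<gamma> k / 2)) < ereal h" "ereal h < 1"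
      using ereal_dense2[OF high] by auto
    have lh: "0 < l" "h < 1"
      using l(1) h(2) by (auto simp: zero_ereal_def one_ereal_def)
    have ev: "\<forall>\<^sub>F k in sequentially. l < 1 - \<beta> k - \<gamma> k / 2"
        "\<forall>\<^sub>F k in sequentially. 1 - \<beta> k - \<gamma> k / 2 < h"
      using less_LiminfD[OF l(2)] Limsup_lessD[OF h(1)] by simp_all
    show ?thesis
      using bounded_weights[OF weights_positive_if_relaxation_bounded_away(1)[OF sum_lim lh ev] _
          weights_positive_if_relaxation_bounded_away(2)[OF sum_lim lh ev] c_alt] lh by simp
  next
    case positive_weights
    note sign = positive_weights(1) and weight = positive_weights(2) and c_alt = positive_weights(3)
    obtain w where w: "0 < ereal w" "ereal w < liminf (\<lambda>k. ereal (\<gamma> k * (2 * \<beta> k + \<gamma> k)))"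
      using ereal_dense2[OF weight] by auto
    have "\<forall>\<^sub>F k in sequentially. w < \<gamma> k * (2 * \<beta> k + \<gamma> k)"
      using less_LiminfD[OF w(2)] by simp
    then have "\<forall>\<^sub>F k in sequentially. w \<le> \<gamma> k * (2 * \<beta> k + \<gamma> k)"
      by eventually_elim simp
    moreover have "\<forall>\<^sub>F k in sequentially. 0 \<le> \<gamma> k * (\<beta> k + \<gamma> k)"
      using nonneg[OF sign] by simp
    ultimately show ?thesis
      using bounded_weights w(1) c_alt by (auto simp: zero_ereal_def)
  next
    case divergent_weights
    note sign = divergent_weights(1) and weight = divergent_weights(2)
      and diverges = divergent_weights(3) and c_inf = divergent_weights(4)
      and c_var = divergent_weights(5)
    obtain m where m: "0 < m" "\<forall>\<^sub>F k in sequentially. m \<le> c k"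
      using c_low c_inf by blast
    obtain M where M: "\<And>k. norm (x k - z) \<le> M"
      using BseqE[OF convergent_imp_Bseq[OF fejer[OF z]]]
      by (metis real_norm_def abs_norm_cancel)
    have d_bound: "norm (d k) \<le> M" for k
    proof -
      have "norm (d k) * norm (d k) \<le> norm (x k - z) * norm (d k)"
        using co[OF z, of k] norm_cauchy_schwarz[of "x k - z" "d k"]
        by (simp add: power2_eq_square)
      then have "norm (d k) \<le> norm (x k - z)"
        by (cases "d k = 0") (auto simp: mult_le_cancel_right)
      then show ?thesis
        using M order_trans by blast
    qed
    have x_bound: "norm (x k) \<le> M + norm z" for k
      using norm_triangle_ineq[of "x k - z" z] M[of k] by simp
    have "\<forall>\<^sub>F k in sequentially. 0 < \<beta> k + \<gamma> k"
      using sum_lim by (rule order_tendstoD) simp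
    then have \<gamma>: "\<forall>\<^sub>F k in sequentially. 0 \<le> \<gamma> k \<and> \<gamma> k \<le> 2"
    proof eventually_elim
      case (elim k)
      have "0 \<le> \<gamma> k"
        using nonneg[OF sign, of k] elim by (simp add: zero_le_mult_iff)
      moreover have "\<gamma> k \<le> 2"
        using par[of k] by linarith
      ultimately show ?case ..
    qed
    have "convergent (\<lambda>k. norm (d k))"
      unfolding d_def
      by (rule resolvent_residual_convergent[OF max c step'[unfolded d_def] \<gamma> defect s x_bound
            d_bound[unfolded d_def] m c_var])
    then have "(\<lambda>k. norm (d k)) \<longlonglongrightarrow> 0"
      using nonneg[OF sign] nonneg[OF weight]
      by (intro limit_zero_of_divergent_weights[OF weighted _ diverges]) auto
    then show ?thesis
      using resolvent_iteration_weak_limit[OF max zer c m fejer] by (simp add: d_def)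
  qed
qed

end
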